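(* Let $k\ge 1$, let $p_1,\dots,p_k$ be distinct primes, let $m_1,\dots,m_k\ge 2$ be integers with $p_i\nmid m_i$ for $i=1,\dots,k$, and let $a_1,\dots,a_k$ be integers with $0\le a_i\le m_i-1$. Put $m:=\max\{m_i: 1\le i\le k\}$, $p:=\max\{p_i:1\le i\le k\}$ and $\delta:=1/(120k^2p^{3m}m^2)$. Then, as $N\to\infty$, $$\bigl|\{0\le n<N:\ e_{p_i}(n)\equiv a_i \pmod{m_i}\ \text{for all } 1\le i\le k\}\bigr| = \frac{N}{m_1\cdots m_k}+O(N^{1-\delta}),$$ where the implied constant depends only on $p_1,\dots,p_k$ and $m_1,\dots,m_k$ (and not on $a_1,\dots,a_k$ or $N$). In particular, for any distinct odd primes $p_1,\dots,p_k$ and any $\varepsilon_1,\dots,\varepsilon_k\in\{0,1\}$, the number of $0\le n<N$ with $e_{p_i}(n)\equiv\varepsilon_i\pmod 2$ for all $i$ is asymptotic to $N/2^k$.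
   Context: For a prime $p$ and a non-negative integer $n$, $e_p(n)$ denotes the exponent of $p$ in the prime factorization of $n!$ (with $e_p(0)=0$). *)

theory Defs
  imports Complex_Main "HOL-Library.Landau_Symbols" "HOL-Number_Theory.Number_Theory"
begin

definition ep :: "nat \<Rightarrow> nat \<Rightarrow> nat" where
  "ep p n = multiplicity p (fact n :: nat)"

end

theory Submission
  imports Defs "HOL-Analysis.Convex"
begin

text \<open>
  By orthogonality of characters it suffices to save a power of \<open>N\<close> in
  \<open>\<Sum>n<N. \<Prod>i<k. \<zeta>\<^sub>i ^ e\<^sub>i(n)\<close>, where \<open>e\<^sub>i(n) = ep (p i) n\<close>, \<open>\<zeta>\<^sub>i ^ m\<^sub>i = 1\<close> and
  some \<open>\<zeta>\<^sub>l \<noteq> 1\<close>.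

  For a single prime, Legendre's recursion \<open>e(a + p n) = n + e(n)\<close> (\<open>a < p\<close>) shows that
  \<open>F\<^sub>s(z) = \<Sum>n<p^s. \<zeta> ^ e(n) * z ^ n\<close> satisfies
  \<open>F\<^sub>s\<^sub>+\<^sub>1(z) = (\<Sum>a<p. z ^ a) * F\<^sub>s(\<zeta> z ^ p)\<close>. As \<open>\<zeta>\<close> is bounded away from \<open>1\<close>, the points
  \<open>z\<close> and \<open>\<zeta> z ^ p\<close> are not both close to \<open>1\<close>, and \<open>F\<^sub>s\<close> is \<open>O(Q powr (1 - \<eta>))\<close> uniformly on the
  unit circle, where \<open>Q = p ^ s\<close>.

  For several primes, let \<open>Q\<^sub>i\<close> be a power of \<open>p\<^sub>i\<close> of size about \<open>X = N powr (1/k)\<close> and average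
  the sum over shifts \<open>h < H\<close> with \<open>H\<close> slightly below \<open>X\<close>. Unless a carry occurs, which is rare,
  \<open>\<zeta>\<^sub>i ^ e\<^sub>i(n + h)\<close> may be replaced by a \<open>Q\<^sub>i\<close>-periodic function up to a factor independent of
  \<open>h\<close>. After Cauchy-Schwarz, the Chinese remainder theorem factors the correlations, all factors
  but the \<open>l\<close>-th are bounded trivially, and Parseval modulo \<open>Q\<^sub>l\<close> bounds the \<open>l\<close>-th by \<open>F\<^sub>s\<close>.
\<close>

section \<open>Digit expansion and the generating sums\<close>

lemma ep_Suc:
  assumes "prime p"
  shows "ep p (Suc n) = ep p n + multiplicity p (Suc n)"
proof -
  have "ep p (Suc n) = multiplicity p (Suc n * fact n)"
    by (simp add: ep_def)
  also have "\<dots> = multiplicity p (Suc n) + multiplicity p (fact n :: nat)"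
    using assms by (intro prime_elem_multiplicity_mult_distrib) auto
  finally show ?thesis by (simp add: ep_def)
qed

lemma ep_0 [simp]: "ep p 0 = 0"
  by (simp add: ep_def)

text \<open>Passing from n to n + 1 changes either side only when p divides n + 1. If n + 1 = p q,
  the left side gains 1 plus the multiplicity of p in q; on the right the 1 goes to the quotient and
  the rest to its factorial.\<close>

lemma ep_div_rec:
  assumes "prime p"
  shows "ep p n = n div p + ep p (n div p)"
proof (induction n)
  case (Suc n)
  have p: "p > 1" using prime_gt_1_nat[OF assms] by simp
  show ?case
  proof (cases "p dvd Suc n")
    case True
    then obtain q where q: "Suc n = p * q" by auto
    have d: "Suc n div p = Suc (n div p)"
      using True p by (simp add: div_Suc dvd_eq_mod_eq_0)
    then have qd: "q = Suc (n div p)" using q p by simp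
    have "multiplicity p (Suc n) = Suc (multiplicity p q)"
      using p q qd unfolding q by (intro multiplicity_times_same) auto
    then have "ep p (Suc n) = n div p + ep p (n div p) + Suc (multiplicity p (Suc (n div p)))"
      using ep_Suc[OF assms, of n] Suc.IH qd by simp
    also have "\<dots> = Suc (n div p) + ep p (Suc (n div p))"
      by (simp add: ep_Suc[OF assms, of "n div p"])
    finally show ?thesis by (simp only: d)
  next
    case False
    then have "Suc n div p = n div p"
      by (simp add: div_Suc dvd_eq_mod_eq_0)
    moreover have "ep p (Suc n) = ep p n"
      using False by (simp add: ep_Suc[OF assms] not_dvd_imp_multiplicity_0)
    ultimately show ?thesis using Suc.IH by (simp only:)
  qed
qed simp

lemma ep_add_mult:
  assumes "prime p" "a < p"
  shows "ep p (a + p * n) = n + ep p n"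
  using ep_div_rec[OF assms(1), of "a + p * n"] assms by simp

text \<open>Stripping off the lowest base-p digit s times by Legendre's recursion shows that the
  digits of \<open>r\<close> do not interact with those of \<open>u\<close>. This later separates
  the low-digit phase from a phase that is constant on blocks of length p^s.\<close>

lemma ep_add_mult_power:
  assumes "prime p" "r < p ^ s"
  shows "ep p (r + p ^ s * u) = ep p r + ep p (p ^ s * u)"
  using assms(2)
proof (induction s arbitrary: r)
  case (Suc s)
  have p: "p > 0" using assms(1) by (simp add: prime_gt_0_nat)
  have lt: "r div p < p ^ s"
    using Suc.prems p by (simp add: less_mult_imp_div_less mult.commute)
  have amod: "r mod p < p" using p by simp
  have "r + p ^ Suc s * u = r mod p + p * (r div p + p ^ s * u)"
    by (simp add: algebra_simps)
  then have "ep p (r + p ^ Suc s * u) = r div p + p ^ s * u + ep p (r div p + p ^ s * u)"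
    using ep_add_mult[OF assms(1) amod] by metis
  also have "\<dots> = (r div p + ep p (r div p)) + (p ^ s * u + ep p (p ^ s * u))"
    using Suc.IH[OF lt] by simp
  also have "r div p + ep p (r div p) = ep p r"
    using ep_div_rec[OF assms(1), of r] by simp
  also have "p ^ s * u + ep p (p ^ s * u) = ep p (p ^ Suc s * u)"
    using ep_add_mult[OF assms(1), of 0 "p ^ s * u"] p by (simp add: mult.assoc)
  finally show ?case .
qed simp

lemma sum_lessThan_mult:
  fixes f :: "nat \<Rightarrow> 'a::comm_monoid_add"
  shows "(\<Sum>n<a * b. f n) = (\<Sum>u<a. \<Sum>v<b. f (u + a * v))"
proof -
  have "(\<Sum>n<a * b. f n) = (\<Sum>v<b. \<Sum>i\<in>{v * a..<v * a + a}. f i)"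
    using sum.nat_group[of f a b] by (simp add: mult.commute)
  also have "\<dots> = (\<Sum>v<b. \<Sum>u<a. f (u + a * v))"
  proof (rule sum.cong[OF refl])
    fix v
    show "(\<Sum>i\<in>{v * a..<v * a + a}. f i) = (\<Sum>u<a. f (u + a * v))"
      using sum.shift_bounds_nat_ivl[of f 0 "v * a" a]
      by (simp add: lessThan_atLeast0 add.commute mult.commute)
  qed
  also have "\<dots> = (\<Sum>u<a. \<Sum>v<b. f (u + a * v))" by (rule sum.swap)
  finally show ?thesis .
qed

lemma generating_sum_ep_Suc:
  fixes \<zeta> z :: "'a::comm_semiring_1"
  assumes "prime p"
  shows "(\<Sum>n<p ^ Suc s. \<zeta> ^ ep p n * z ^ n) =
         (\<Sum>a<p. z ^ a) * (\<Sum>n<p ^ s. \<zeta> ^ ep p n * (\<zeta> * z ^ p) ^ n)"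
proof -
  have "(\<Sum>n<p ^ Suc s. \<zeta> ^ ep p n * z ^ n) =
        (\<Sum>a<p. \<Sum>n<p ^ s. \<zeta> ^ ep p (a + p * n) * z ^ (a + p * n))"
    by (simp add: sum_lessThan_mult)
  also have "\<dots> = (\<Sum>a<p. \<Sum>n<p ^ s. z ^ a * (\<zeta> ^ ep p n * (\<zeta> * z ^ p) ^ n))"
  proof (intro sum.cong refl)
    fix a n assume "a \<in> {..<p}"
    then have "ep p (a + p * n) = n + ep p n" using ep_add_mult[OF assms] by simp
    then show "\<zeta> ^ ep p (a + p * n) * z ^ (a + p * n) = z ^ a * (\<zeta> ^ ep p n * (\<zeta> * z ^ p) ^ n)"
      by (simp only: power_add power_mult power_mult_distrib) (simp only: mult_ac)
  qed
  finally show ?thesis by (simp add: sum_product)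
qed

section \<open>Geometric sums on the unit circle and decay of the generating sums\<close>

lemma norm_root_of_unity:
  fixes \<zeta> :: complex
  assumes "\<zeta> ^ m = 1" "m > 0"
  shows "norm \<zeta> = 1"
proof -
  have "norm \<zeta> ^ m = 1" using assms by (metis norm_one norm_power)
  then show ?thesis using assms(2) power_eq_imp_eq_base[of "norm \<zeta>" m 1] by simp
qed

text \<open>The powers \<zeta>^j with j < m sum to 0, so m is the sum of the 1 - \<zeta>^j, and each
  of these has norm at most j |1 - \<zeta>|.\<close>

lemma norm_one_minus_root_of_unity_ge:
  fixes \<zeta> :: complex
  assumes "\<zeta> ^ m = 1" "\<zeta> \<noteq> 1" "m > 0"
  shows "2 / real m \<le> norm (1 - \<zeta>)"
proof -
  have n1: "norm \<zeta> = 1"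
    using norm_root_of_unity assms by blast
  have "(\<Sum>j<m. \<zeta> ^ j) = 0"
    using assms by (simp add: sum_gp_strict)
  then have "of_nat m = (\<Sum>j<m. 1 - \<zeta> ^ j)"
    by (simp add: sum_subtractf)
  then have "real m = norm (\<Sum>j<m. 1 ^ j - \<zeta> ^ j)"
    by (simp only: power_one flip: norm_of_nat[where 'a = complex])
  also have "\<dots> \<le> (\<Sum>j<m. real j * norm (1 - \<zeta>))"
    by (intro sum_norm_le norm_power_diff) (simp_all add: n1)
  also have "\<dots> = (\<Sum>j<m. real j) * norm (1 - \<zeta>)"
    by (simp add: sum_distrib_right)
  also have "(\<Sum>j<m. real j) = real m * (real m - 1) / 2"
    by (induction m) (simp_all add: field_simps)
  finally have "real m * 1 \<le> real m * ((real m - 1) / 2 * norm (1 - \<zeta>))"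
    by simp
  then have "1 \<le> (real m - 1) / 2 * norm (1 - \<zeta>)"
    using assms(3) by (subst (asm) mult_le_cancel_left_pos) auto
  also have "\<dots> \<le> real m / 2 * norm (1 - \<zeta>)"
    by (intro mult_right_mono) auto
  finally show ?thesis using assms(3) by (simp add: field_simps)
qed

text \<open>By the parallelogram law |1 + z|^2 = 4 - |1 - z|^2, and 4 - d^2 is at most the square of
  2 - d^2/4.\<close>

lemma norm_one_plus_unit_le:
  fixes z :: complex
  assumes "norm z = 1" "0 \<le> d" "d \<le> norm (1 - z)"
  shows "norm (1 + z) \<le> 2 - d\<^sup>2 / 4"
proof -
  have "(norm (1 + z))\<^sup>2 + (norm (1 - z))\<^sup>2 = 2 + 2 * (norm z)\<^sup>2"
    unfolding cmod_power2 by (simp add: power2_eq_square algebra_simps)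
  then have eq: "(norm (1 + z))\<^sup>2 = 4 - (norm (1 - z))\<^sup>2"
    using assms by simp
  have d2: "d\<^sup>2 \<le> (norm (1 - z))\<^sup>2" using assms by (simp add: power_mono)
  have "(norm (1 + z))\<^sup>2 \<le> (2 - d\<^sup>2 / 4)\<^sup>2"
  proof -
    have "(2 - d\<^sup>2 / 4)\<^sup>2 = 4 - d\<^sup>2 + (d\<^sup>2 / 4)\<^sup>2"
      by (simp add: power2_eq_square algebra_simps)
    then show ?thesis using eq d2 zero_le_power2[of "d\<^sup>2 / 4"] by linarith
  qed
  moreover have "d\<^sup>2 \<le> 4"
    using eq d2 zero_le_power2[of "norm (1 + z)"] by linarith
  ultimately show ?thesis
    using power2_le_imp_le[of "norm (1 + z)" "2 - d\<^sup>2 / 4"] by simp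
qed

text \<open>The saving comes from the two terms 1 + z alone; the other p - 2 terms are bounded
  trivially.\<close>

lemma norm_geometric_sum_le:
  fixes z :: complex
  assumes "norm z = 1" "0 \<le> d" "d \<le> norm (1 - z)" "p \<ge> 2"
  shows "norm (\<Sum>a<p. z ^ a) \<le> real p - d\<^sup>2 / 4"
proof -
  have "(\<Sum>a<p. z ^ a) = (1 + z) + (\<Sum>a\<in>{2..<p}. z ^ a)"
    using assms(4) by (simp add: lessThan_atLeast0 sum.atLeast_Suc_lessThan numeral_2_eq_2)
  then have "norm (\<Sum>a<p. z ^ a) \<le> norm (1 + z) + norm (\<Sum>a\<in>{2..<p}. z ^ a)"
    by (simp only: norm_triangle_ineq)
  also have "norm (\<Sum>a\<in>{2..<p}. z ^ a) \<le> real (p - 2)"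
    using sum_norm_le[of "{2..<p}" "\<lambda>a. z ^ a" "\<lambda>_. 1"] assms(1) by (simp add: norm_power)
  also have "norm (1 + z) \<le> 2 - d\<^sup>2 / 4"
    by (rule norm_one_plus_unit_le) fact+
  finally show ?thesis using assms(4) by (simp add: of_nat_diff)
qed

text \<open>The relative saving guaranteed by two consecutive digit sums: it equals d^2 / (4 p) for
  the threshold d = 2 / (m (p + 1)) beyond which one of the two sums must drop.\<close>

definition decay :: "nat \<Rightarrow> nat \<Rightarrow> real" where
  "decay p m = 1 / (real p * (real p + 1)\<^sup>2 * (real m)\<^sup>2)"

lemma norm_two_digit_factors_le:
  fixes \<zeta> z :: complex
  assumes "p \<ge> 2" "\<zeta> ^ m = 1" "\<zeta> \<noteq> 1" "m > 0" "norm z = 1"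
  shows "norm (\<Sum>a<p. z ^ a) * norm (\<Sum>a<p. (\<zeta> * z ^ p) ^ a) \<le> (real p)\<^sup>2 * (1 - decay p m)"
proof -
  define w where "w = \<zeta> * z ^ p"
  \<comment> \<open>Chosen so that d + p d = 2 / m, the lower bound for |1 - \<zeta>|.\<close>
  define d where "d = 2 / (real m * (real p + 1))"
  have n1: "norm \<zeta> = 1"
    using norm_root_of_unity assms by blast
  have nw: "norm w = 1" using n1 assms by (simp add: w_def norm_mult norm_power)
  have d0: "d \<ge> 0" by (simp add: d_def)
  have eq: "real p - d\<^sup>2 / 4 = real p * (1 - decay p m)"
  proof -
    have "d\<^sup>2 / 4 = 1 / ((real m)\<^sup>2 * (real p + 1)\<^sup>2)"
      by (simp add: d_def power_divide power_mult_distrib)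
    moreover have "real p * decay p m = 1 / ((real m)\<^sup>2 * (real p + 1)\<^sup>2)"
      using assms by (simp add: decay_def)
    ultimately show ?thesis by (simp add: algebra_simps)
  qed
  have le: "norm (\<Sum>a<p. x ^ a) \<le> real p" if "norm x = 1" for x :: complex
    using norm_geometric_sum_le[of x 0 p] that assms by simp
  have "2 / real m \<le> norm (1 - \<zeta>)"
    by (rule norm_one_minus_root_of_unity_ge) fact+
  \<comment> \<open>This identity yields |1 - \<zeta>| \<le> |1 - w| + p |1 - z|, so
    \<open>z\<close> and \<open>w\<close> cannot both lie within d of 1.\<close>
  also have "1 - \<zeta> = (1 - w) + \<zeta> * (z ^ p - 1 ^ p)"
    by (simp add: w_def algebra_simps)
  also have "norm \<dots> \<le> norm (1 - w) + norm (z ^ p - 1 ^ p)"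
    using norm_triangle_ineq[of "1 - w" "\<zeta> * (z ^ p - 1 ^ p)"] n1 by (simp add: norm_mult)
  also have "norm (z ^ p - 1 ^ p) \<le> real p * norm (z - 1)"
    by (rule norm_power_diff) (simp_all add: assms)
  also have "norm (z - 1) = norm (1 - z)" by (rule norm_minus_commute)
  finally have sum: "2 / real m \<le> norm (1 - w) + real p * norm (1 - z)" by simp
  have "d \<le> norm (1 - w) \<or> d \<le> norm (1 - z)"
  proof (rule ccontr)
    assume "\<not> ?thesis"
    then have "norm (1 - w) + real p * norm (1 - z) < d + real p * d"
      by (intro add_less_le_mono mult_left_mono) auto
    also have "\<dots> = 2 / real m"
      using assms by (simp add: d_def divide_simps)
    finally show False using sum by simp
  qed
  then show ?thesis
  proof
    assume "d \<le> norm (1 - w)"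
    then have "norm (\<Sum>a<p. w ^ a) \<le> real p * (1 - decay p m)"
      using norm_geometric_sum_le[OF nw d0 _ assms(1)] eq by linarith
    then have "norm (\<Sum>a<p. z ^ a) * norm (\<Sum>a<p. w ^ a) \<le> real p * (real p * (1 - decay p m))"
      using le[of z] assms by (intro mult_mono) auto
    then show ?thesis by (simp add: w_def power2_eq_square mult_ac)
  next
    assume "d \<le> norm (1 - z)"
    then have *: "norm (\<Sum>a<p. z ^ a) \<le> real p * (1 - decay p m)"
      using norm_geometric_sum_le[OF assms(5) d0 _ assms(1)] eq by linarith
    have "norm (\<Sum>a<p. z ^ a) * norm (\<Sum>a<p. w ^ a) \<le> (real p * (1 - decay p m)) * real p"
      using le[OF nw] * by (intro mult_mono) (auto intro: order_trans[OF norm_ge_zero])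
    then show ?thesis by (simp add: w_def power2_eq_square mult_ac)
  qed
qed

lemma decay_bounds:
  assumes "p \<ge> 2" "m > 0"
  shows "0 < decay p m" "decay p m < 1"
proof -
  have "1 * 1 * 1 < real p * (real p + 1)\<^sup>2 * (real m)\<^sup>2"
    using assms by (intro mult_less_le_imp_less mult_strict_mono) auto
  then show "0 < decay p m" "decay p m < 1"
    using assms by (auto simp: decay_def divide_simps)
qed

text \<open>Digits are peeled off in pairs: a single digit sum may have full size p, and only the
  product of two consecutive ones is known to save. Hence the exponent \<open>s div 2\<close> and
  the two base cases.\<close>

lemma norm_generating_sum_ep_le:
  fixes \<zeta> z :: complex
  assumes "prime p" "\<zeta> ^ m = 1" "\<zeta> \<noteq> 1" "m > 0" "norm z = 1"
  shows "norm (\<Sum>n<p ^ s. \<zeta> ^ ep p n * z ^ n) \<le> real p ^ s * (1 - decay p m) ^ (s div 2)"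
  using assms(5)
proof (induction s arbitrary: z rule: less_induct)
  case (less s)
  have p2: "p \<ge> 2" using assms(1) by (simp add: prime_ge_2_nat)
  have n1: "norm \<zeta> = 1"
    using norm_root_of_unity assms by blast
  consider "s = 0" | "s = 1" | t where "s = Suc (Suc t)"
    by (metis One_nat_def old.nat.exhaust)
  then show ?case
  proof cases
    case 1
    then show ?thesis by simp
  next
    case 2
    then show ?thesis
      using generating_sum_ep_Suc[OF assms(1), where s = 0 and \<zeta> = \<zeta> and z = z]
        norm_geometric_sum_le[of z 0 p] less.prems p2 by simp
  next
    case 3
    define w where "w = \<zeta> * z ^ p"
    define v where "v = \<zeta> * w ^ p"
    have nv: "norm v = 1" using n1 less.prems by (simp add: v_def w_def norm_mult norm_power)
    have "(\<Sum>n<p ^ s. \<zeta> ^ ep p n * z ^ n) =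
          (\<Sum>a<p. z ^ a) * ((\<Sum>a<p. w ^ a) * (\<Sum>n<p ^ t. \<zeta> ^ ep p n * v ^ n))"
      unfolding 3 generating_sum_ep_Suc[OF assms(1)] v_def w_def by simp
    then have "norm (\<Sum>n<p ^ s. \<zeta> ^ ep p n * z ^ n) =
        (norm (\<Sum>a<p. z ^ a) * norm (\<Sum>a<p. w ^ a)) * norm (\<Sum>n<p ^ t. \<zeta> ^ ep p n * v ^ n)"
      by (simp add: norm_mult)
    also have "\<dots> \<le> ((real p)\<^sup>2 * (1 - decay p m)) * (real p ^ t * (1 - decay p m) ^ (t div 2))"
      using less.IH[OF _ nv, of t] 3 decay_bounds[OF p2 assms(4)]
        norm_two_digit_factors_le[OF p2 assms(2-4) less.prems, folded w_def]
      by (intro mult_mono[where a = "norm _ * norm _"]) auto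
    also have "\<dots> = real p ^ s * (1 - decay p m) ^ (s div 2)"
      using 3 by (simp add: power2_eq_square)
    finally show ?thesis .
  qed
qed

section \<open>Correlations of periodic functions\<close>

lemma sum_unity_root_orthogonal:
  fixes n n' :: nat
  assumes "Q > 0"
  defines "\<omega> \<equiv> cis (2 * pi / real Q)"
  shows "(\<Sum>j<Q. \<omega> ^ (j * n) * cnj (\<omega> ^ (j * n'))) =
         (if n mod Q = n' mod Q then of_nat Q else 0)"
proof -
  have one: "\<omega> ^ Q = 1"
    using assms by (simp add: \<omega>_def DeMoivre)
  have red: "\<omega> ^ i = \<omega> ^ (i mod Q)" for i
  proof -
    have "\<omega> ^ i = \<omega> ^ (Q * (i div Q) + i mod Q)" by simp
    also have "\<dots> = \<omega> ^ (i mod Q)"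
      by (simp only: power_add power_mult one power_one mult_1_left)
    finally show ?thesis .
  qed
  have norm: "norm (\<omega> ^ i) = 1" for i by (simp add: \<omega>_def norm_power)
  have unit: "\<omega> ^ i * cnj (\<omega> ^ i) = 1" for i
    using complex_norm_square[of "\<omega> ^ i"] norm by simp
  define w where "w = \<omega> ^ n * cnj (\<omega> ^ n')"
  have terms: "\<omega> ^ (j * n) * cnj (\<omega> ^ (j * n')) = w ^ j" for j
    by (simp add: w_def power_mult_distrib flip: power_mult) (simp add: mult.commute)
  have "w ^ Q = (\<omega> ^ Q) ^ n * cnj ((\<omega> ^ Q) ^ n')"
    by (simp add: w_def power_mult_distrib mult.commute flip: power_mult)
  then have wQ: "w ^ Q = 1" by (simp add: one)
  show ?thesis
  proof (cases "n mod Q = n' mod Q")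
    case True
    then have "w = 1" unfolding w_def using red unit by metis
    then show ?thesis using True by (simp only: terms) simp
  next
    case False
    have "w \<noteq> 1"
    proof
      assume "w = 1"
      then have "\<omega> ^ n' = \<omega> ^ n * (\<omega> ^ n' * cnj (\<omega> ^ n'))"
        unfolding w_def by (simp add: mult.left_commute)
      then have "\<omega> ^ (n mod Q) = \<omega> ^ (n' mod Q)"
        using unit red by (metis mult_1_right)
      then have "cis (2 * pi * real (n mod Q) / real Q) = cis (2 * pi * real (n' mod Q) / real Q)"
        by (simp add: \<omega>_def DeMoivre mult_ac)
      moreover have "inj_on (\<lambda>i. cis (2 * pi * real i / real Q)) {..<Q}"
        using bij_betw_roots_unity[OF assms(1)] by (simp add: bij_betw_def)
      ultimately show False
        using False assms(1) by (auto dest!: inj_onD)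
    qed
    then have "(\<Sum>j<Q. w ^ j) = 0" using wQ by (simp add: sum_gp_strict)
    then show ?thesis using False by (simp only: terms if_False)
  qed
qed

lemma Parseval_unity_roots:
  fixes c :: "nat \<Rightarrow> complex"
  assumes "Q > 0"
  defines "\<omega> \<equiv> cis (2 * pi / real Q)"
  shows "(\<Sum>h<Q. (norm (\<Sum>x<Q. c x * \<omega> ^ (h * x)))\<^sup>2) = real Q * (\<Sum>x<Q. (norm (c x))\<^sup>2)"
proof -
  have "complex_of_real (\<Sum>h<Q. (norm (\<Sum>x<Q. c x * \<omega> ^ (h * x)))\<^sup>2) =
        (\<Sum>h<Q. (\<Sum>x<Q. c x * \<omega> ^ (h * x)) * cnj (\<Sum>y<Q. c y * \<omega> ^ (h * y)))"
    by (simp only: of_real_sum complex_norm_square)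
  also have "\<dots> = (\<Sum>h<Q. \<Sum>x<Q. \<Sum>y<Q. c x * cnj (c y) * (\<omega> ^ (h * x) * cnj (\<omega> ^ (h * y))))"
    by (simp add: sum_product mult_ac)
  also have "\<dots> = (\<Sum>x<Q. \<Sum>y<Q. \<Sum>h<Q. c x * cnj (c y) * (\<omega> ^ (h * x) * cnj (\<omega> ^ (h * y))))"
    by (subst sum.swap, rule sum.cong[OF refl], rule sum.swap)
  also have "\<dots> = (\<Sum>x<Q. \<Sum>y<Q. c x * cnj (c y) * (if x mod Q = y mod Q then of_nat Q else 0))"
    unfolding \<omega>_def sum_unity_root_orthogonal[OF assms(1), symmetric]
    by (simp only: sum_distrib_left)
  also have "\<dots> = (\<Sum>x<Q. \<Sum>y<Q. if y = x then c x * cnj (c x) * of_nat Q else 0)"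
    by (intro sum.cong refl) auto
  also have "\<dots> = (\<Sum>x<Q. c x * cnj (c x) * of_nat Q)"
    by (intro sum.cong refl) (simp add: sum.delta)
  also have "\<dots> = complex_of_real (real Q * (\<Sum>x<Q. (norm (c x))\<^sup>2))"
    by (simp add: complex_norm_square sum_distrib_left mult_ac del: of_real_power)
  finally show ?thesis by (simp only: of_real_eq_iff)
qed

text \<open>As a function of \<open>h\<close> the correlation is a cyclic convolution, so its
  Fourier transform modulo Q is a transform of \<open>G\<close>, bounded by \<open>B\<close>, times
  a transform of \<open>K\<close>. Parseval turns the sum over \<open>h\<close> into a sum over
  frequencies, and a second use of it evaluates the mean square of the \<open>K\<close>
  factor.\<close>

lemma sum_norm_square_correlation_le:
  fixes G K :: "nat \<Rightarrow> complex"
  assumes Q: "Q > 0"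
    and per: "\<And>n. G (n mod Q) = G n"
    and K: "\<And>r. norm (K r) \<le> 1"
    and B: "\<And>z. norm z = 1 \<Longrightarrow> norm (\<Sum>n<Q. G n * z ^ n) \<le> B"
  shows "(\<Sum>h<Q. (norm (\<Sum>r<Q. G (r + h) * cnj (K r)))\<^sup>2) \<le> real Q * B\<^sup>2"
proof -
  define \<omega> where "\<omega> = cis (2 * pi / real Q)"
  define F where "F x = (\<Sum>n<Q. G n * cnj (\<omega> ^ (x * n)))" for x
  define FK where "FK x = (\<Sum>r<Q. cnj (K r) * \<omega> ^ (x * r))" for x
  have F_le: "norm (F x) \<le> B" for x
    using B[of "cnj (\<omega> ^ x)"] by (simp add: F_def power_mult \<omega>_def norm_power)
  \<comment> \<open>Fourier inversion: summing over the frequency \<open>x\<close> leaves only n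
    congruent to r + h modulo Q.\<close>
  have inv: "of_nat Q * (\<Sum>r<Q. G (r + h) * cnj (K r)) = (\<Sum>x<Q. F x * FK x * \<omega> ^ (h * x))" for h
  proof -
    have "(\<Sum>x<Q. F x * FK x * \<omega> ^ (h * x)) =
          (\<Sum>x<Q. \<Sum>n<Q. \<Sum>r<Q. G n * cnj (K r) * (\<omega> ^ (x * (r + h)) * cnj (\<omega> ^ (x * n))))"
      unfolding F_def FK_def sum_product
      by (simp add: sum_distrib_right sum_distrib_left power_add algebra_simps)
    also have "\<dots> = (\<Sum>n<Q. \<Sum>r<Q. \<Sum>x<Q. G n * cnj (K r) * (\<omega> ^ (x * (r + h)) * cnj (\<omega> ^ (x * n))))"
      by (subst sum.swap, rule sum.cong[OF refl], rule sum.swap)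
    also have "\<dots> = (\<Sum>n<Q. \<Sum>r<Q. G n * cnj (K r) * (if (r + h) mod Q = n mod Q then of_nat Q else 0))"
      unfolding \<omega>_def sum_unity_root_orthogonal[OF Q, symmetric]
      by (simp only: sum_distrib_left)
    also have "\<dots> = (\<Sum>r<Q. \<Sum>n<Q. if n = (r + h) mod Q then G n * cnj (K r) * of_nat Q else 0)"
      by (subst sum.swap) (intro sum.cong refl, auto)
    also have "\<dots> = (\<Sum>r<Q. G (r + h) * cnj (K r) * of_nat Q)"
      using Q by (intro sum.cong refl) (simp add: sum.delta per)
    finally show ?thesis by (simp add: sum_distrib_left mult_ac)
  qed
  have "(real Q)\<^sup>2 * (\<Sum>h<Q. (norm (\<Sum>r<Q. G (r + h) * cnj (K r)))\<^sup>2) =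
        (\<Sum>h<Q. (norm (of_nat Q * (\<Sum>r<Q. G (r + h) * cnj (K r))))\<^sup>2)"
    unfolding norm_mult power_mult_distrib by (simp add: sum_distrib_left)
  also have "\<dots> = real Q * (\<Sum>x<Q. (norm (F x * FK x))\<^sup>2)"
    unfolding inv unfolding \<omega>_def by (rule Parseval_unity_roots[OF Q])
  also have "\<dots> \<le> real Q * (\<Sum>x<Q. B\<^sup>2 * (norm (FK x))\<^sup>2)"
    using F_le by (intro mult_left_mono sum_mono)
      (auto simp: norm_mult power_mult_distrib intro!: mult_right_mono power_mono)
  also have "\<dots> = real Q * B\<^sup>2 * (\<Sum>x<Q. (norm (FK x))\<^sup>2)"
    by (simp add: sum_distrib_left mult_ac)
  also have "(\<Sum>x<Q. (norm (FK x))\<^sup>2) = real Q * (\<Sum>r<Q. (norm (cnj (K r)))\<^sup>2)"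
    unfolding FK_def \<omega>_def by (rule Parseval_unity_roots[OF Q])
  also have "(\<Sum>r<Q. (norm (cnj (K r)))\<^sup>2) \<le> (\<Sum>r<Q. 1)"
    using K by (intro sum_mono) (simp add: power_le_one)
  finally have "(real Q)\<^sup>2 * (\<Sum>h<Q. (norm (\<Sum>r<Q. G (r + h) * cnj (K r)))\<^sup>2) \<le>
      real Q * B\<^sup>2 * (real Q * (\<Sum>r<Q. 1))"
    by (simp add: mult_left_mono)
  then have "(real Q)\<^sup>2 * (\<Sum>h<Q. (norm (\<Sum>r<Q. G (r + h) * cnj (K r)))\<^sup>2) \<le>
      (real Q)\<^sup>2 * (real Q * B\<^sup>2)"
    by (simp add: power2_eq_square mult_ac)
  then show ?thesis using Q by (subst (asm) mult_le_cancel_left_pos) auto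
qed

section \<open>Chinese remainder factorization and averaging over shifts\<close>

lemma bij_betw_mod_coprime:
  fixes a b :: nat
  assumes "coprime a b" "a > 0" "b > 0"
  shows "bij_betw (\<lambda>n. (n mod a, n mod b)) {..<a * b} ({..<a} \<times> {..<b})"
proof -
  have ex1: "\<exists>!x. x < a * b \<and> [x = u] (mod a) \<and> [x = v] (mod b)" for u v
    using binary_chinese_remainder_unique_nat[of a b u v] assms by simp
  have "inj_on (\<lambda>n. (n mod a, n mod b)) {..<a * b}"
  proof (rule inj_onI)
    fix x y assume "x \<in> {..<a * b}" "y \<in> {..<a * b}" "(x mod a, x mod b) = (y mod a, y mod b)"
    then show "x = y" using ex1[of y y] by (auto simp: cong_def)
  qed
  moreover have "(\<lambda>n. (n mod a, n mod b)) ` {..<a * b} = {..<a} \<times> {..<b}"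
  proof (intro equalityI subsetI)
    fix y assume y: "y \<in> {..<a} \<times> {..<b}"
    obtain x where "x < a * b" "[x = fst y] (mod a)" "[x = snd y] (mod b)"
      using ex1[of "fst y" "snd y"] by blast
    then show "y \<in> (\<lambda>n. (n mod a, n mod b)) ` {..<a * b}"
      using y by (intro image_eqI[of _ _ x]) (auto simp: cong_def)
  qed (use assms in auto)
  ultimately show ?thesis by (simp add: bij_betw_def)
qed

lemma sum_mult_periodic_coprime:
  fixes f g :: "nat \<Rightarrow> 'a::comm_semiring_1"
  assumes "coprime a b" "a > 0" "b > 0"
    and "\<And>n. f (n mod a) = f n" "\<And>n. g (n mod b) = g n"
  shows "(\<Sum>n<a * b. f n * g n) = (\<Sum>r<a. f r) * (\<Sum>s<b. g s)"
proof -
  have "(\<Sum>r<a. f r) * (\<Sum>s<b. g s) = (\<Sum>(r, s)\<in>{..<a} \<times> {..<b}. f r * g s)"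
    by (simp add: sum_product sum.cartesian_product)
  also have "\<dots> = (\<Sum>n<a * b. f (n mod a) * g (n mod b))"
    using sum.reindex_bij_betw[OF bij_betw_mod_coprime[OF assms(1-3)], of "\<lambda>(r, s). f r * g s"]
    by simp
  finally show ?thesis by (simp add: assms)
qed

lemma mod_dvd_periodic:
  fixes f :: "nat \<Rightarrow> 'a"
  assumes "\<And>n. f (n mod a) = f n" "a dvd b"
  shows "f (n mod b) = f n"
  using assms(1)[of "n mod b"] assms(1)[of n] assms(2) by (simp add: mod_mod_cancel)

lemma sum_prod_periodic_coprime:
  fixes f :: "nat \<Rightarrow> nat \<Rightarrow> 'a::comm_semiring_1"
  assumes "\<And>i. i < k \<Longrightarrow> Q i > 0"
    and "\<And>i j. i < k \<Longrightarrow> j < k \<Longrightarrow> i \<noteq> j \<Longrightarrow> coprime (Q i) (Q j)"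
    and "\<And>i n. i < k \<Longrightarrow> f i (n mod Q i) = f i n"
  shows "(\<Sum>n<(\<Prod>i<k. Q i). \<Prod>i<k. f i n) = (\<Prod>i<k. \<Sum>r<Q i. f i r)"
  using assms
proof (induction k)
  case (Suc k)
  have cop: "coprime (\<Prod>i<k. Q i) (Q k)"
    using Suc.prems(2) by (intro prod_coprime_left) auto
  have per: "(\<Prod>i<k. f i (n mod (\<Prod>i<k. Q i))) = (\<Prod>i<k. f i n)" for n
  proof (rule prod.cong[OF refl])
    fix i assume "i \<in> {..<k}"
    then show "f i (n mod (\<Prod>i<k. Q i)) = f i n"
      using Suc.prems(3)[of i] mod_dvd_periodic[of "f i" "Q i" "\<Prod>i<k. Q i" n] by auto
  qed
  have pos: "(\<Prod>i<k. Q i) > 0" using Suc.prems(1) by (intro prod_pos) auto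
  have "(\<Sum>n<(\<Prod>i<Suc k. Q i). \<Prod>i<Suc k. f i n) =
        (\<Sum>n<(\<Prod>i<k. Q i) * Q k. (\<Prod>i<k. f i n) * f k n)" by simp
  also have "\<dots> = (\<Sum>n<(\<Prod>i<k. Q i). \<Prod>i<k. f i n) * (\<Sum>s<Q k. f k s)"
    using Suc.prems pos by (intro sum_mult_periodic_coprime[OF cop]) (auto simp: per)
  also have "(\<Sum>n<(\<Prod>i<k. Q i). \<Prod>i<k. f i n) = (\<Prod>i<k. \<Sum>r<Q i. f i r)"
    using Suc.prems by (intro Suc.IH) auto
  finally show ?case by simp
qed simp

text \<open>The range is enlarged to \<open>N div M + 1\<close> full periods, which nonnegativity
  permits.\<close>

lemma sum_periodic_le:
  fixes f :: "nat \<Rightarrow> real"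
  assumes "M > 0" "\<And>n. f (n mod M) = f n" "\<And>n. f n \<ge> 0"
  shows "(\<Sum>n<N. f n) \<le> (real N / real M + 1) * (\<Sum>n<M. f n)"
proof -
  have "N \<le> M * (N div M + 1)"
    using assms(1) by (metis Suc_eq_plus1 dividend_less_times_div less_imp_le_nat mult_Suc_right add.commute)
  then have "(\<Sum>n<N. f n) \<le> (\<Sum>n<M * (N div M + 1). f n)"
    using assms by (intro sum_mono2) auto
  also have "\<dots> = (\<Sum>u<M. \<Sum>v<N div M + 1. f (u + M * v))"
    by (rule sum_lessThan_mult)
  also have "\<dots> = (\<Sum>u<M. \<Sum>v<N div M + 1. f u)"
  proof (intro sum.cong refl)
    fix u v
    show "f (u + M * v) = f u"
      using assms(2)[of "u + M * v"] assms(2)[of u] by simp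
  qed
  also have "\<dots> = (real (N div M) + 1) * (\<Sum>n<M. f n)"
    by (simp add: sum_distrib_left add.commute)
  also have "\<dots> \<le> (real N / real M + 1) * (\<Sum>n<M. f n)"
    using assms(3) of_nat_div_le_of_nat[of N M, where 'a = real] by (intro mult_right_mono sum_nonneg) auto
  finally show ?thesis .
qed

text \<open>Each unit shift of the range exchanges one term at either end, so a shift by h costs at
  most 2 h. Averaging over all h < H replaces single terms by block sums of length H.\<close>

lemma van_der_Corput_shift:
  fixes z :: "nat \<Rightarrow> 'a::real_normed_vector"
  assumes "H > 0" "\<And>n. norm (z n) \<le> 1"
  shows "norm (\<Sum>n<N. z n) \<le> 2 * real H + (\<Sum>n<N. norm (\<Sum>h<H. z (n + h))) / real H"
proof -
  have shift: "norm ((\<Sum>n<N. z n) - (\<Sum>n<N. z (n + h))) \<le> 2 * real h" for h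
  proof (induction h)
    case (Suc h)
    have "(\<Sum>n<N. z (n + h)) - (\<Sum>n<N. z (n + Suc h)) = z h - z (N + h)"
      using sum_lessThan_telescope'[of "\<lambda>n. z (n + h)" N] by (simp add: sum_subtractf)
    moreover have "norm (z h - z (N + h)) \<le> 2"
      using norm_triangle_ineq4[of "z h" "z (N + h)"] assms(2)[of h] assms(2)[of "N + h"] by linarith
    ultimately have "norm ((\<Sum>n<N. z (n + h)) - (\<Sum>n<N. z (n + Suc h))) \<le> 2" by simp
    then show ?case
      using Suc norm_triangle_ineq[of "(\<Sum>n<N. z n) - (\<Sum>n<N. z (n + h))"
          "(\<Sum>n<N. z (n + h)) - (\<Sum>n<N. z (n + Suc h))"] by simp
  qed simp
  define S where "S = (\<Sum>n<N. z n)"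
  have "real H *\<^sub>R S = (\<Sum>h<H. S - (\<Sum>n<N. z (n + h))) + (\<Sum>n<N. \<Sum>h<H. z (n + h))"
    unfolding sum_subtractf sum.swap[of _ "{..<H}" "{..<N}"] by (simp add: sum_constant_scaleR)
  then have "real H * norm S \<le>
      norm (\<Sum>h<H. S - (\<Sum>n<N. z (n + h))) + norm (\<Sum>n<N. \<Sum>h<H. z (n + h))"
    by (metis norm_triangle_ineq norm_scaleR abs_of_nat)
  also have "norm (\<Sum>h<H. S - (\<Sum>n<N. z (n + h))) \<le> (\<Sum>h<H. 2 * real H)"
    unfolding S_def by (intro sum_norm_le order_trans[OF shift]) auto
  also have "norm (\<Sum>n<N. \<Sum>h<H. z (n + h)) \<le> (\<Sum>n<N. norm (\<Sum>h<H. z (n + h)))"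
    by (rule norm_sum)
  finally have "real H * norm S \<le> real H * (2 * real H) + (\<Sum>n<N. norm (\<Sum>h<H. z (n + h)))"
    by simp
  then show ?thesis using assms(1) by (simp add: S_def field_simps)
qed

text \<open>Opening the square gives, for each pair of shifts, a sum over a full period of the
  product, which the Chinese remainder theorem splits into the correlations
  \<open>\<gamma> i h h'\<close>. Those with i different from l are at most \<open>Q i\<close>; the
  one for l is controlled on average over \<open>h\<close>.\<close>

lemma mean_square_prod_periodic_le:
  fixes G :: "nat \<Rightarrow> nat \<Rightarrow> complex"
  assumes Q: "\<And>i. i < k \<Longrightarrow> Q i > 0"
    and cop: "\<And>i j. i < k \<Longrightarrow> j < k \<Longrightarrow> i \<noteq> j \<Longrightarrow> coprime (Q i) (Q j)"
    and per: "\<And>i n. i < k \<Longrightarrow> G i (n mod Q i) = G i n"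
    and G1: "\<And>i n. i < k \<Longrightarrow> norm (G i n) \<le> 1"
    and l: "l < k"
    and B: "\<And>z. norm z = 1 \<Longrightarrow> norm (\<Sum>n<Q l. G l n * z ^ n) \<le> B"
    and H: "H \<le> Q l"
  shows "(\<Sum>n<(\<Prod>i<k. Q i). (norm (\<Sum>h<H. \<Prod>i<k. G i (n + h)))\<^sup>2) \<le>
         real (\<Prod>i<k. Q i) * real H * sqrt (real H / real (Q l)) * B"
proof -
  define M where "M = (\<Prod>i<k. Q i)"
  define \<gamma> where "\<gamma> i h h' = (\<Sum>r<Q i. G i (r + h) * cnj (G i (r + h')))" for i h h'
  have B0: "B \<ge> 0" using B[of 1] norm_ge_zero by (meson norm_one order_trans)
  have Ql: "Q l > 0" using Q l by simp
  have shift: "G i ((n mod Q i) + h) = G i (n + h)" if "i < k" for i n h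
    using per[OF that, of "n mod Q i + h"] per[OF that, of "n + h"] by (simp add: mod_simps)
  have fact: "(\<Sum>n<M. \<Prod>i<k. G i (n + h) * cnj (G i (n + h'))) = (\<Prod>i<k. \<gamma> i h h')" for h h'
    unfolding M_def \<gamma>_def
    by (rule sum_prod_periodic_coprime) (use Q cop shift in auto)
  have "complex_of_real (\<Sum>n<M. (norm (\<Sum>h<H. \<Prod>i<k. G i (n + h)))\<^sup>2) =
        (\<Sum>n<M. (\<Sum>h<H. \<Prod>i<k. G i (n + h)) * cnj (\<Sum>h'<H. \<Prod>i<k. G i (n + h')))"
    by (simp only: of_real_sum complex_norm_square)
  also have "\<dots> = (\<Sum>n<M. \<Sum>h<H. \<Sum>h'<H. \<Prod>i<k. G i (n + h) * cnj (G i (n + h')))"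
    by (simp add: sum_product prod.distrib)
  also have "\<dots> = (\<Sum>h<H. \<Sum>h'<H. \<Sum>n<M. \<Prod>i<k. G i (n + h) * cnj (G i (n + h')))"
    by (subst sum.swap, rule sum.cong[OF refl], rule sum.swap)
  also have "\<dots> = (\<Sum>h<H. \<Sum>h'<H. \<Prod>i<k. \<gamma> i h h')"
    by (simp only: fact)
  finally have eq: "complex_of_real (\<Sum>n<M. (norm (\<Sum>h<H. \<Prod>i<k. G i (n + h)))\<^sup>2) =
      (\<Sum>h<H. \<Sum>h'<H. \<Prod>i<k. \<gamma> i h h')" .
  have "(\<Sum>n<M. (norm (\<Sum>h<H. \<Prod>i<k. G i (n + h)))\<^sup>2) =
      norm (complex_of_real (\<Sum>n<M. (norm (\<Sum>h<H. \<Prod>i<k. G i (n + h)))\<^sup>2))"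
    by (simp only: norm_of_real abs_of_nonneg sum_nonneg zero_le_power2)
  also have "\<dots> \<le> (\<Sum>h<H. \<Sum>h'<H. norm (\<Prod>i<k. \<gamma> i h h'))"
    unfolding eq by (intro sum_norm_le norm_sum)
  also have "\<dots> \<le> (\<Sum>h<H. \<Sum>h'<H. real M / real (Q l) * norm (\<gamma> l h h'))"
  proof (intro sum_mono)
    fix h h'
    have le: "norm (\<gamma> i h h') \<le> real (Q i)" if "i < k" for i
    proof -
      have "norm (\<gamma> i h h') \<le> (\<Sum>r<Q i. 1)"
        unfolding \<gamma>_def using G1[OF that]
        by (intro sum_norm_le) (auto simp: norm_mult intro!: mult_le_one)
      then show ?thesis by simp
    qed
    have "norm (\<Prod>i<k. \<gamma> i h h') = norm (\<gamma> l h h') * (\<Prod>i\<in>{..<k} - {l}. norm (\<gamma> i h h'))"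
      using l by (simp add: prod.remove[of _ l] prod_norm norm_mult)
    also have "\<dots> \<le> norm (\<gamma> l h h') * (\<Prod>i\<in>{..<k} - {l}. real (Q i))"
      using le by (intro mult_left_mono prod_mono) auto
    also have "(\<Prod>i\<in>{..<k} - {l}. real (Q i)) = real M / real (Q l)"
      using l Ql by (simp add: M_def prod.remove[of _ l])
    finally show "norm (\<Prod>i<k. \<gamma> i h h') \<le> real M / real (Q l) * norm (\<gamma> l h h')"
      by (simp add: mult.commute)
  qed
  also have "\<dots> = real M / real (Q l) * (\<Sum>h'<H. \<Sum>h<H. norm (\<gamma> l h h'))"
    by (subst sum.swap) (simp add: sum_distrib_left)
  also have "\<dots> \<le> real M / real (Q l) * (\<Sum>h'<H. sqrt (real (Q l) * real H) * B)"
  proof (intro mult_left_mono sum_mono)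
    fix h'
    have "(\<Sum>h<H. norm (\<gamma> l h h'))\<^sup>2 \<le> (\<Sum>h<H. (norm (\<gamma> l h h'))\<^sup>2) * real H"
      using sum_squared_le_sum_of_squares[of "\<lambda>h. norm (\<gamma> l h h')" "{..<H}"] by simp
    \<comment> \<open>Extending \<open>h\<close> to a full period, possible as H \<le> Q l, makes
      the Parseval bound applicable with K r = G l (r + h').\<close>
    also have "(\<Sum>h<H. (norm (\<gamma> l h h'))\<^sup>2) \<le> (\<Sum>h<Q l. (norm (\<gamma> l h h'))\<^sup>2)"
      using H by (intro sum_mono2) auto
    also have "\<dots> \<le> real (Q l) * B\<^sup>2"
      unfolding \<gamma>_def using Ql per[OF l] G1[OF l] B
      by (intro sum_norm_square_correlation_le) auto
    finally have "(\<Sum>h<H. norm (\<gamma> l h h'))\<^sup>2 \<le> real (Q l) * B\<^sup>2 * real H"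
      by (simp add: mult_right_mono)
    then have "(\<Sum>h<H. norm (\<gamma> l h h'))\<^sup>2 \<le> (sqrt (real (Q l) * real H) * B)\<^sup>2"
      by (simp add: power_mult_distrib mult_ac)
    then show "(\<Sum>h<H. norm (\<gamma> l h h')) \<le> sqrt (real (Q l) * real H) * B"
      using B0 by (elim power2_le_imp_le) auto
  qed auto
  also have "\<dots> = real M * real H * (sqrt (real (Q l) * real H) / real (Q l)) * B"
    by simp
  also have "sqrt (real (Q l) * real H) / real (Q l) = sqrt (real H / real (Q l))"
    using Ql by (simp add: real_sqrt_mult real_sqrt_divide field_simps)
  finally show ?thesis by (simp add: M_def)
qed

section \<open>Exponential sums\<close>

lemma exists_power_between:
  fixes X :: real
  assumes "b \<ge> (2::nat)" "X \<ge> 1"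
  shows "\<exists>s. X \<le> real (b ^ s) \<and> real (b ^ s) \<le> real b * X"
proof -
  define s where "s = (LEAST s. X \<le> real (b ^ s))"
  obtain n where "X < real b ^ n" using real_arch_pow[of "real b" X] assms by auto
  then have ge: "X \<le> real (b ^ s)"
    unfolding s_def by (intro LeastI[of "\<lambda>s. X \<le> real (b ^ s)" n]) simp
  have "real (b ^ s) \<le> real b * X"
  proof (cases s)
    case 0
    have "1 * 1 \<le> real b * X" using assms by (intro mult_mono) auto
    then show ?thesis using 0 by simp
  next
    case (Suc t)
    then have "\<not> X \<le> real (b ^ t)"
      unfolding s_def by (intro not_less_Least) simp
    then show ?thesis using Suc by (simp add: mult_left_mono)
  qed
  with ge show ?thesis by blast
qed

text \<open>Turns a saving that is geometric in the number of digits into a power of p^s. With c the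
  decay, ln p \<le> p gives 1 - c \<le> p powr (- c / p); passing from \<open>s div 2\<close> to (s
  - 1) / 2 costs a factor p powr (c / (2 p)), which is at most p.\<close>

lemma decay_power_le:
  assumes "p \<ge> 2" "m > 0"
  shows "(1 - decay p m) ^ (s div 2) \<le>
         real p * real (p ^ s) powr (- (decay p m / (2 * real p)))"
proof -
  define c where "c = decay p m"
  have c: "0 < c" "c < 1" using decay_bounds[OF assms] by (auto simp: c_def)
  have p: "real p \<ge> 2" using assms by simp
  have "1 - c \<le> 1 + (- (c / real p) * ln (real p))"
  proof -
    have "c / real p * ln (real p) \<le> c / real p * real p"
      using c p ln_le_minus_one[of "real p"] by (intro mult_left_mono) auto
    then show ?thesis using p by simp
  qed
  also have "\<dots> \<le> exp (- (c / real p) * ln (real p))"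
    by (rule exp_ge_add_one_self)
  also have "\<dots> = real p powr (- (c / real p))"
    using p by (simp add: powr_def)
  finally have "(1 - c) ^ (s div 2) \<le> (real p powr (- (c / real p))) ^ (s div 2)"
    using c by (intro power_mono) auto
  also have "\<dots> = real p powr (- (c / real p) * real (s div 2))"
    using p by (simp add: powr_powr flip: powr_realpow)
  also have "\<dots> \<le> real p powr (1 + real s * - (c / (2 * real p)))"
  proof (rule powr_mono)
    have "c / real p * ((real s - 1) / 2) \<le> c / real p * real (s div 2)"
    proof (rule mult_left_mono)
      have "s \<le> 2 * (s div 2) + 1" by linarith
      then have "real s \<le> real (2 * (s div 2) + 1)" by (simp only: of_nat_le_iff)
      then show "(real s - 1) / 2 \<le> real (s div 2)" by simp
    qed (use c in auto)
    moreover have "c / (2 * real p) \<le> 1"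
      using c p by (simp add: field_simps)
    moreover have "c / real p * ((real s - 1) / 2) = real s * (c / (2 * real p)) - c / (2 * real p)"
      by (simp add: diff_divide_distrib right_diff_distrib mult.commute)
    ultimately show "- (c / real p) * real (s div 2) \<le> 1 + real s * - (c / (2 * real p))"
      by simp
  qed (use p in auto)
  also have "\<dots> = real p powr 1 * real p powr (real s * - (c / (2 * real p)))"
    by (rule powr_add)
  also have "\<dots> = real p * real (p ^ s) powr (- (c / (2 * real p)))"
    using p by (simp add: powr_powr flip: powr_realpow)
  finally show ?thesis by (simp add: c_def)
qed

text \<open>The n counted are exactly those for which n mod Q + h reaches Q for some h < H, so that
  a carry occurs. Each period contains at most H of them.\<close>

lemma sum_of_bool_near_top_le:
  assumes "Q > 0"
  shows "(\<Sum>n<N. of_bool (Q < n mod Q + H) :: real) \<le> (real N / real Q + 1) * real H"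
proof -
  have "(\<Sum>n<N. of_bool (Q < n mod Q + H) :: real) \<le>
        (real N / real Q + 1) * (\<Sum>n<Q. of_bool (Q < n mod Q + H))"
    using assms by (intro sum_periodic_le) auto
  also have "(\<Sum>n<Q. of_bool (Q < n mod Q + H) :: real) = real (card {n. n < Q \<and> Q < n + H})"
    by (simp add: of_bool_def sum.If_cases Int_def)
  also have "card {n. n < Q \<and> Q < n + H} \<le> card {Q - H..<Q}"
    by (intro card_mono) auto
  also have "\<dots> \<le> H" by simp
  finally show ?thesis by (simp add: mult_left_mono)
qed

text \<open>No residue overflows while h < H, so the higher digits of n + h are those of n. They
  contribute a single factor \<open>U\<close>, independent of \<open>h\<close> and of norm
  1.\<close>

lemma norm_block_sum_eq:
  fixes \<zeta> :: "nat \<Rightarrow> complex"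
  assumes "\<And>i. i < k \<Longrightarrow> prime (p i)"
    and "\<And>i. i < k \<Longrightarrow> norm (\<zeta> i) = 1"
    and "\<And>i. i < k \<Longrightarrow> n mod (p i ^ s i) + H \<le> p i ^ s i"
  shows "norm (\<Sum>h<H. \<Prod>i<k. \<zeta> i ^ ep (p i) (n + h)) =
         norm (\<Sum>h<H. \<Prod>i<k. \<zeta> i ^ ep (p i) ((n + h) mod (p i ^ s i)))"
proof -
  define U where "U = (\<Prod>i<k. \<zeta> i ^ ep (p i) (p i ^ s i * (n div p i ^ s i)))"
  have nU: "norm U = 1"
    using assms(2) by (simp add: U_def norm_power flip: prod_norm)
  have "(\<Sum>h<H. \<Prod>i<k. \<zeta> i ^ ep (p i) (n + h)) =
        (\<Sum>h<H. (\<Prod>i<k. \<zeta> i ^ ep (p i) ((n + h) mod (p i ^ s i))) * U)"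
    unfolding U_def prod.distrib[symmetric] power_add[symmetric]
  proof (intro sum.cong prod.cong refl arg_cong2[where f = power])
    fix h i assume hi: "h \<in> {..<H}" "i \<in> {..<k}"
    define Q where "Q = p i ^ s i"
    have lt: "n mod Q + h < Q" using assms(3)[of i] hi by (simp add: Q_def)
    have md: "(n + h) mod Q = n mod Q + h"
      using lt by (metis mod_add_left_eq mod_less)
    have "n + h = (n mod Q + h) + Q * (n div Q)" by simp
    then have "ep (p i) (n + h) = ep (p i) (n mod Q + h) + ep (p i) (Q * (n div Q))"
      using ep_add_mult_power[of "p i" "n mod Q + h" "s i" "n div Q"] assms(1)[of i] lt hi
      unfolding Q_def by simp
    then show "ep (p i) (n + h) = ep (p i) ((n + h) mod p i ^ s i) +
        ep (p i) (p i ^ s i * (n div p i ^ s i))"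
      by (simp only: md[unfolded Q_def] Q_def)
  qed
  also have "\<dots> = (\<Sum>h<H. \<Prod>i<k. \<zeta> i ^ ep (p i) ((n + h) mod (p i ^ s i))) * U"
    by (simp add: sum_distrib_right)
  finally show ?thesis by (simp add: norm_mult nU)
qed

text \<open>The first summand is the mean square of the periodic model; the second charges the
  trivial bound H^2 to every n at which some i admits a carry.\<close>

lemma sum_square_block_sums_le:
  fixes \<zeta> :: "nat \<Rightarrow> complex"
  assumes prime: "\<And>i. i < k \<Longrightarrow> prime (p i)"
    and inj: "inj_on p {..<k}"
    and root: "\<And>i. i < k \<Longrightarrow> \<zeta> i ^ m i = 1" "\<And>i. i < k \<Longrightarrow> m i > 0"
    and l: "l < k" "\<zeta> l \<noteq> 1"
    and Q: "\<And>i. Q i = p i ^ s i"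
    and H: "H \<le> Q l"
    and B: "real (Q l) * (1 - decay (p l) (m l)) ^ (s l div 2) \<le> B"
  shows "(\<Sum>n<N. (norm (\<Sum>h<H. \<Prod>i<k. \<zeta> i ^ ep (p i) (n + h)))\<^sup>2) \<le>
    (real N + real (\<Prod>i<k. Q i)) * real H * sqrt (real H / real (Q l)) * B +
    (real H)\<^sup>2 * (\<Sum>i<k. (real N / real (Q i) + 1) * real H)"
proof -
  define M where "M = (\<Prod>i<k. Q i)"
  define G where "G i n = \<zeta> i ^ ep (p i) (n mod Q i)" for i n
  have Qpos: "Q i > 0" if "i < k" for i
    using prime_gt_0_nat[OF prime[OF that]] by (simp add: Q)
  have M: "M > 0" unfolding M_def using Qpos by (intro prod_pos) auto
  have norm1: "norm (\<zeta> i) = 1" if "i < k" for i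
    using norm_root_of_unity root that by blast
  have normG: "norm (G i n) = 1" if "i < k" for i n
    using norm1[OF that] by (simp add: G_def norm_power)
  have norm_block: "norm (\<Sum>h<H. \<Prod>i<k. \<zeta> i ^ ep (p i) (n + h)) \<le> real H" for n
  proof -
    have "norm (\<Sum>h<H. \<Prod>i<k. \<zeta> i ^ ep (p i) (n + h)) \<le> (\<Sum>h<H. 1)"
      using norm1 by (intro sum_norm_le) (simp add: norm_power flip: prod_norm)
    then show ?thesis by simp
  qed
  have pw: "(norm (\<Sum>h<H. \<Prod>i<k. \<zeta> i ^ ep (p i) (n + h)))\<^sup>2 \<le>
      (norm (\<Sum>h<H. \<Prod>i<k. G i (n + h)))\<^sup>2 + (real H)\<^sup>2 * (\<Sum>i<k. of_bool (Q i < n mod Q i + H))"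
    for n
  proof (cases "\<forall>i<k. n mod Q i + H \<le> Q i")
    case True
    then have "norm (\<Sum>h<H. \<Prod>i<k. \<zeta> i ^ ep (p i) (n + h)) = norm (\<Sum>h<H. \<Prod>i<k. G i (n + h))"
      unfolding G_def Q by (intro norm_block_sum_eq prime norm1) auto
    then show ?thesis by (simp add: sum_nonneg)
  next
    case False
    then obtain j where j: "j < k" "Q j < n mod Q j + H" by auto
    have "1 = (of_bool (Q j < n mod Q j + H) :: real)" using j by simp
    also have "\<dots> \<le> (\<Sum>i<k. of_bool (Q i < n mod Q i + H))"
      using j by (intro member_le_sum) auto
    finally have "(real H)\<^sup>2 * 1 \<le> (real H)\<^sup>2 * (\<Sum>i<k. of_bool (Q i < n mod Q i + H))"
      by (intro mult_left_mono) auto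
    moreover have "(norm (\<Sum>h<H. \<Prod>i<k. \<zeta> i ^ ep (p i) (n + h)))\<^sup>2 \<le> (real H)\<^sup>2"
      using norm_block by (intro power_mono) auto
    ultimately show ?thesis using zero_le_power2[of "norm (\<Sum>h<H. \<Prod>i<k. G i (n + h))"] by linarith
  qed
  have cop: "coprime (Q i) (Q j)" if "i < k" "j < k" "i \<noteq> j" for i j
  proof -
    have "p i \<noteq> p j" using inj that by (auto dest: inj_onD)
    then show ?thesis using primes_coprime[OF prime[OF that(1)] prime[OF that(2)]]
      by (simp add: Q)
  qed
  have per: "(\<Prod>i<k. G i (n mod M + h)) = (\<Prod>i<k. G i (n + h))" for n h
  proof (rule prod.cong[OF refl])
    fix i assume "i \<in> {..<k}"
    then have "Q i dvd M" unfolding M_def by (intro dvd_prodI) auto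
    then have "(n mod M + h) mod Q i = (n + h) mod Q i"
      by (metis mod_add_left_eq mod_mod_cancel)
    then show "G i (n mod M + h) = G i (n + h)" by (simp add: G_def)
  qed
  have gen: "norm (\<Sum>n<Q l. G l n * z ^ n) \<le> B" if "norm z = 1" for z
  proof -
    have "(\<Sum>n<Q l. G l n * z ^ n) = (\<Sum>n<p l ^ s l. \<zeta> l ^ ep (p l) n * z ^ n)"
      by (simp add: G_def Q)
    also have "norm \<dots> \<le> real (p l) ^ s l * (1 - decay (p l) (m l)) ^ (s l div 2)"
      using that l root prime by (intro norm_generating_sum_ep_le) auto
    finally show ?thesis using B by (simp add: Q)
  qed
  \<comment> \<open>The block sums of the periodic model have period \<open>M\<close> in n, so the
    range is covered by at most N / M + 1 periods; multiplied by M this becomes the factor N +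
    M.\<close>
  have "(\<Sum>n<N. (norm (\<Sum>h<H. \<Prod>i<k. G i (n + h)))\<^sup>2) \<le>
      (real N / real M + 1) * (\<Sum>n<M. (norm (\<Sum>h<H. \<Prod>i<k. G i (n + h)))\<^sup>2)"
    using M by (intro sum_periodic_le) (simp_all add: per)
  also have "\<dots> \<le> (real N / real M + 1) * (real M * real H * sqrt (real H / real (Q l)) * B)"
    unfolding M_def using Qpos cop normG l H gen
    by (intro mult_left_mono mean_square_prod_periodic_le) (auto simp: G_def prod_nonneg)
  also have "\<dots> = (real N + real M) * real H * sqrt (real H / real (Q l)) * B"
    using M by (simp add: field_simps)
  finally have main: "(\<Sum>n<N. (norm (\<Sum>h<H. \<Prod>i<k. G i (n + h)))\<^sup>2) \<le>
      (real N + real M) * real H * sqrt (real H / real (Q l)) * B" .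
  have "(\<Sum>n<N. \<Sum>i<k. of_bool (Q i < n mod Q i + H) :: real) =
      (\<Sum>i<k. \<Sum>n<N. of_bool (Q i < n mod Q i + H))"
    by (rule sum.swap)
  also have "\<dots> \<le> (\<Sum>i<k. (real N / real (Q i) + 1) * real H)"
    using Qpos by (intro sum_mono sum_of_bool_near_top_le) auto
  finally have exc: "(\<Sum>n<N. \<Sum>i<k. of_bool (Q i < n mod Q i + H) :: real) \<le>
      (\<Sum>i<k. (real N / real (Q i) + 1) * real H)" .
  have "(\<Sum>n<N. (norm (\<Sum>h<H. \<Prod>i<k. \<zeta> i ^ ep (p i) (n + h)))\<^sup>2) \<le>
      (\<Sum>n<N. (norm (\<Sum>h<H. \<Prod>i<k. G i (n + h)))\<^sup>2) +
      (real H)\<^sup>2 * (\<Sum>n<N. \<Sum>i<k. of_bool (Q i < n mod Q i + H))"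
    unfolding sum_distrib_left[of "(real H)\<^sup>2" _ "{..<N}"] sum.distrib[symmetric]
    using pw by (rule sum_mono)
  also have "\<dots> \<le> (real N + real M) * real H * sqrt (real H / real (Q l)) * B +
      (real H)\<^sup>2 * (\<Sum>i<k. (real N / real (Q i) + 1) * real H)"
    using main exc by (intro add_mono mult_left_mono) auto
  finally show ?thesis by (simp add: M_def)
qed

text \<open>Every \<open>Q i\<close> is taken of size X = N powr (1/k), so that the full period
  \<open>M\<close> is O(N), and \<open>H\<close> of size X powr (1 - \<beta>). The mean square of
  the blocks then saves X powr (-\<beta>/2), Cauchy-Schwarz halves the exponent, and X powr
  (-\<beta>/4) = N powr (-\<beta>/(4k)).\<close>

lemma norm_exp_sum_le:
  fixes \<zeta> :: "nat \<Rightarrow> complex" and \<beta> P :: real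
  assumes k: "k > 0"
    and prime: "\<And>i. i < k \<Longrightarrow> prime (p i)"
    and inj: "inj_on p {..<k}"
    and root: "\<And>i. i < k \<Longrightarrow> \<zeta> i ^ m i = 1" "\<And>i. i < k \<Longrightarrow> m i > 0"
    and l: "l < k" "\<zeta> l \<noteq> 1"
    and P: "\<And>i. i < k \<Longrightarrow> real (p i) \<le> P"
    and \<beta>: "0 < \<beta>" "\<beta> \<le> 1" "\<beta> \<le> decay (p l) (m l) / (2 * real (p l))"
    and N: "N > 0"
  shows "norm (\<Sum>n<N. \<Prod>i<k. \<zeta> i ^ ep (p i) n) \<le>
    (2 + sqrt ((1 + P ^ k) * (2 * P\<^sup>2) + 2 * real k)) * real N powr (1 - \<beta> / (4 * real k))"
proof -
  define X where "X = real N powr (1 / real k)"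
  have X1: "X \<ge> 1" using N by (simp add: X_def ge_one_powr_ge_zero)
  have XN: "X \<le> real N"
    using powr_mono[of "1 / real k" 1 "real N"] N k by (simp add: X_def)
  have p2: "p i \<ge> 2" if "i < k" for i using prime_ge_2_nat[OF prime[OF that]] .
  have P2: "P \<ge> 2" using P[OF l(1)] p2[OF l(1)] by linarith
  have "\<forall>i. \<exists>s. i < k \<longrightarrow> X \<le> real (p i ^ s) \<and> real (p i ^ s) \<le> real (p i) * X"
    using exists_power_between[OF p2 X1] by blast
  then obtain s where s: "\<And>i. i < k \<Longrightarrow> X \<le> real (p i ^ s i) \<and> real (p i ^ s i) \<le> real (p i) * X"
    by metis
  define Q where "Q i = p i ^ s i" for i
  have XQ: "X \<le> real (Q i)" and QPX: "real (Q i) \<le> P * X" if "i < k" for i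
  proof -
    show "X \<le> real (Q i)" using s[OF that] by (simp add: Q_def)
    have "real (Q i) \<le> real (p i) * X" using s[OF that] by (simp add: Q_def)
    also have "\<dots> \<le> P * X" using P[OF that] X1 by (intro mult_right_mono) auto
    finally show "real (Q i) \<le> P * X" .
  qed
  define M where "M = (\<Prod>i<k. Q i)"
  have "real M \<le> (\<Prod>i<k. P * X)"
    unfolding M_def of_nat_prod using QPX by (intro prod_mono) auto
  also have "\<dots> = P ^ k * X ^ k" by (simp add: power_mult_distrib)
  also have "X ^ k = real N"
    using N k X1 by (simp add: X_def powr_powr flip: powr_realpow)
  finally have MN: "real M \<le> P ^ k * real N" .

  \<comment> \<open>At this size carries have frequency of order H / X, at most X powr (-\<beta>).
    As X powr (1 - \<beta>) is at least 1, the floor is positive and loses at most a factor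
    2.\<close>
  define H where "H = nat \<lfloor>X powr (1 - \<beta>)\<rfloor>"
  have X1\<beta>: "1 \<le> X powr (1 - \<beta>)" using X1 \<beta> by (simp add: ge_one_powr_ge_zero)
  then have H1: "H \<ge> 1" by (simp add: H_def le_nat_iff)
  have Hle: "real H \<le> X powr (1 - \<beta>)" using X1\<beta> by (simp add: H_def)
  have "X powr (1 - \<beta>) \<le> real H + 1" using X1\<beta> unfolding H_def by linarith
  then have Hge: "X powr (1 - \<beta>) \<le> 2 * real H" using H1 by simp
  have HX: "real H \<le> X" using Hle powr_mono[of "1 - \<beta>" 1 X] X1 \<beta> by simp
  have HQ: "H \<le> Q l" using HX XQ[OF l(1)] by linarith

  \<comment> \<open>The generating sum bound for \<open>p l\<close>, with the prime weakened to
    \<open>P\<close> and the saving in powers of \<open>Q l\<close> to one in powers of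
    \<open>X\<close>.\<close>
  define B where "B = real (Q l) * (P * X powr (- \<beta>))"
  have B: "real (Q l) * (1 - decay (p l) (m l)) ^ (s l div 2) \<le> B"
    unfolding B_def
  proof (intro mult_left_mono)
    have "(1 - decay (p l) (m l)) ^ (s l div 2) \<le>
        real (p l) * real (Q l) powr (- (decay (p l) (m l) / (2 * real (p l))))"
      unfolding Q_def using p2 root l by (intro decay_power_le) auto
    also have "\<dots> \<le> P * X powr (- \<beta>)"
    proof (intro mult_mono)
      have "real (Q l) powr (- (decay (p l) (m l) / (2 * real (p l)))) \<le> real (Q l) powr (- \<beta>)"
        using \<beta> XQ[OF l(1)] X1 by (intro powr_mono) auto
      also have "\<dots> \<le> X powr (- \<beta>)"
        using \<beta> XQ[OF l(1)] X1 by (intro powr_mono2') auto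
      finally show "real (Q l) powr (- (decay (p l) (m l) / (2 * real (p l)))) \<le> X powr (- \<beta>)" .
    qed (use P l P2 in auto)
    finally show "(1 - decay (p l) (m l)) ^ (s l div 2) \<le> P * X powr (- \<beta>)" .
  qed auto

  \<comment> \<open>\<open>T\<close> is the relative saving in the mean square: \<open>B\<close> has
    the order X powr (1 - \<beta>) of \<open>H\<close> itself, which leaves the factor sqrt (H / Q
    l) of order X powr (-\<beta>/2). The carry term saves X powr (-\<beta>), which is no
    worse.\<close>
  define T where "T = X powr (- \<beta> / 2)"
  have T0: "T \<ge> 0" by (simp add: T_def)
  have TB: "T * T = X powr (- \<beta>)" using X1 by (simp add: T_def flip: powr_add)
  have T_le: "X powr (- \<beta>) \<le> T" using X1 \<beta> unfolding T_def by (intro powr_mono) auto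

  have sqrt_le: "sqrt (real H / real (Q l)) * B \<le> 2 * P\<^sup>2 * real H * T"
  proof -
    have Qpos: "real (Q l) > 0" using XQ[OF l(1)] X1 by linarith
    have "X * X powr (- \<beta>) = X powr (1 - \<beta>)" using X1 by (simp add: powr_diff powr_minus divide_simps)
    then have X2: "X * (T * T) \<le> 2 * real H" using Hge TB by simp
    have "real H * real (Q l) * (T * T) \<le> real H * (P * X) * (T * T)"
      using QPX[OF l(1)] T0 by (intro mult_right_mono mult_left_mono) auto
    also have "\<dots> = P * real H * (X * (T * T))" by simp
    also have "\<dots> \<le> P * real H * (2 * real H)"
      using X2 P2 by (intro mult_left_mono) auto
    also have "\<dots> \<le> (2 * P * real H)\<^sup>2"
    proof -
      have "P * 1 \<le> P * (2 * P)" using P2 by (intro mult_left_mono) auto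
      then have "P * (2 * (real H)\<^sup>2) \<le> P * (2 * P) * (2 * (real H)\<^sup>2)"
        by (intro mult_right_mono) auto
      then show ?thesis by (simp add: power2_eq_square mult_ac)
    qed
    finally have "(sqrt (real H * real (Q l)) * T)\<^sup>2 \<le> (2 * P * real H)\<^sup>2"
      by (simp add: power_mult_distrib power2_eq_square[of T])
    then have le: "sqrt (real H * real (Q l)) * T \<le> 2 * P * real H"
      using P2 by (elim power2_le_imp_le) auto
    have "sqrt (real H / real (Q l)) * real (Q l) = sqrt (real H * real (Q l))"
      using Qpos by (simp add: real_sqrt_divide real_sqrt_mult field_simps)
    then have "sqrt (real H / real (Q l)) * B = P * T * (sqrt (real H * real (Q l)) * T)"
      unfolding B_def TB[symmetric] by (metis mult.assoc mult.commute)
    also have "\<dots> \<le> P * T * (2 * P * real H)"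
      using le P2 T0 by (intro mult_left_mono) auto
    finally show ?thesis by (simp add: power2_eq_square mult_ac)
  qed

  \<comment> \<open>1 + P^k bounds (N + M) / N, 2 P^2 is the constant of \<open>sqrt_le\<close>, and
    each of the k carry terms contributes 2.\<close>
  define D where "D = (1 + P ^ k) * (2 * P\<^sup>2) + 2 * real k"
  have D0: "D \<ge> 0" using P2 by (simp add: D_def)
  define W where "W = (\<Sum>n<N. (norm (\<Sum>h<H. \<Prod>i<k. \<zeta> i ^ ep (p i) (n + h)))\<^sup>2)"
  have "W \<le> (real N + real (\<Prod>i<k. Q i)) * real H * sqrt (real H / real (Q l)) * B +
    (real H)\<^sup>2 * (\<Sum>i<k. (real N / real (Q i) + 1) * real H)"
    unfolding W_def
    using prime inj root l Q_def HQ B by (rule sum_square_block_sums_le)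
  also have "\<dots> = (real N + real M) * (real H * (sqrt (real H / real (Q l)) * B)) +
    (real H)\<^sup>2 * (\<Sum>i<k. (real N / real (Q i) + 1) * real H)"
    by (simp add: M_def)
  also have "\<dots> \<le> ((1 + P ^ k) * real N) * (real H * (2 * P\<^sup>2 * real H * T)) +
    (real H)\<^sup>2 * (\<Sum>i<k. 2 * real N * T)"
  proof (rule add_mono)
    have "real N + real M \<le> (1 + P ^ k) * real N" using MN by (simp add: algebra_simps)
    moreover have "real H * (sqrt (real H / real (Q l)) * B) \<le> real H * (2 * P\<^sup>2 * real H * T)"
      using sqrt_le by (rule mult_left_mono) simp
    ultimately show "(real N + real M) * (real H * (sqrt (real H / real (Q l)) * B)) \<le>
        ((1 + P ^ k) * real N) * (real H * (2 * P\<^sup>2 * real H * T))"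
      by (rule mult_mono) (use P2 in \<open>auto simp: B_def\<close>)
    show "(real H)\<^sup>2 * (\<Sum>i<k. (real N / real (Q i) + 1) * real H) \<le>
        (real H)\<^sup>2 * (\<Sum>i<k. 2 * real N * T)"
    proof (intro mult_left_mono sum_mono)
      fix i assume "i \<in> {..<k}"
      then have "real N / real (Q i) \<le> real N / X"
        using XQ[of i] X1 by (intro divide_left_mono) auto
      \<comment> \<open>This absorbs the summand 1, due to the incomplete last period, into N /
        X.\<close>
      moreover have "1 \<le> real N / X" using XN X1 by simp
      ultimately have "(real N / real (Q i) + 1) * real H \<le> (2 * (real N / X)) * X powr (1 - \<beta>)"
        using Hle by (intro mult_mono) auto
      also have "\<dots> = 2 * real N * X powr (- \<beta>)"
        using X1 by (simp add: powr_diff powr_minus divide_simps)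
      also have "\<dots> \<le> 2 * real N * T" using T_le by (intro mult_left_mono) auto
      finally show "(real N / real (Q i) + 1) * real H \<le> 2 * real N * T" .
    qed auto
  qed
  also have "\<dots> = D * real N * (real H)\<^sup>2 * T"
    by (simp add: D_def power2_eq_square algebra_simps)
  finally have W: "W \<le> D * real N * (real H)\<^sup>2 * T" .

  \<comment> \<open>The square root of \<open>T\<close>, which is what Cauchy-Schwarz over n leaves
    of the saving.\<close>
  define R where "R = X powr (- \<beta> / 4)"
  have RR: "R\<^sup>2 = T" using X1 by (simp add: R_def T_def power2_eq_square flip: powr_add)
  define A where "A = (\<Sum>n<N. norm (\<Sum>h<H. \<Prod>i<k. \<zeta> i ^ ep (p i) (n + h)))"
  have "A\<^sup>2 \<le> W * real N"
    unfolding A_def W_def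
    using sum_squared_le_sum_of_squares[of "\<lambda>n. norm (\<Sum>h<H. \<Prod>i<k. \<zeta> i ^ ep (p i) (n + h))" "{..<N}"]
    by simp
  also have "\<dots> \<le> D * real N * (real H)\<^sup>2 * T * real N"
    using W by (intro mult_right_mono) auto
  also have "\<dots> = (sqrt D * real N * real H * R)\<^sup>2"
    using D0 by (simp add: power_mult_distrib RR power2_eq_square[of "real N"])
  finally have "A \<le> sqrt D * real N * real H * R"
    using D0 by (elim power2_le_imp_le) (auto simp: R_def)
  then have AH: "A / real H \<le> sqrt D * (real N * R)" using H1 by (simp add: field_simps)
  have NR: "real N * R = real N powr (1 - \<beta> / (4 * real k))"
    using N powr_add[of "real N" 1 "- (\<beta> / (4 * real k))"]
    by (simp add: R_def X_def powr_powr mult.commute)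
  \<comment> \<open>The boundary term 2 H of the shift averaging must meet the same bound; the
    exponent 1 - \<beta> in \<open>H\<close> ensures this even for k = 1, when X = N.\<close>
  have HN: "real H \<le> real N powr (1 - \<beta> / (4 * real k))"
  proof -
    have "X powr (1 - \<beta>) \<le> real N powr (1 - \<beta>)"
      using XN X1 \<beta> by (intro powr_mono2) auto
    also have "\<dots> \<le> real N powr (1 - \<beta> / (4 * real k))"
    proof (rule powr_mono)
      have "\<beta> / (4 * real k) \<le> \<beta> / 1"
        using k \<beta> by (intro divide_left_mono) auto
      then show "1 - \<beta> \<le> 1 - \<beta> / (4 * real k)" by simp
    qed (use N in auto)
    finally show ?thesis using Hle by linarith
  qed
  have "norm (\<Sum>n<N. \<Prod>i<k. \<zeta> i ^ ep (p i) n) \<le> 2 * real H + A / real H"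
    unfolding A_def using H1 norm_root_of_unity[OF root]
    by (intro van_der_Corput_shift) (auto simp: norm_power simp flip: prod_norm)
  also have "\<dots> \<le> (2 + sqrt D) * real N powr (1 - \<beta> / (4 * real k))"
    using AH HN by (simp add: NR distrib_right)
  finally show ?thesis by (simp add: D_def)
qed

section \<open>Equidistribution\<close>

text \<open>The indicator of each congruence, times \<open>m i\<close>, is a full character sum
  modulo \<open>m i\<close>; the product of these sums over i expands over the frequency vectors
  \<open>c\<close>.\<close>

lemma card_ep_cong_eq_exp_sums:
  fixes k N :: nat and p m a :: "nat \<Rightarrow> nat"
  assumes m: "\<And>i. i < k \<Longrightarrow> m i > 0"
  defines "\<omega> \<equiv> \<lambda>i. cis (2 * pi / real (m i))"
  shows "of_nat (card {n. n < N \<and> (\<forall>i<k. [ep (p i) n = a i] (mod m i))}) * (\<Prod>i<k. of_nat (m i)) =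
    (\<Sum>c\<in>PiE {..<k} (\<lambda>i. {..<m i}). (\<Prod>i<k. cnj (\<omega> i ^ (c i * a i))) *
       (\<Sum>n<N. \<Prod>i<k. (\<omega> i ^ c i) ^ ep (p i) n))"
proof -
  have indicator: "(\<Prod>i<k. \<Sum>c<m i. \<omega> i ^ (c * ep (p i) n) * cnj (\<omega> i ^ (c * a i))) =
      of_bool (\<forall>i<k. [ep (p i) n = a i] (mod m i)) * (\<Prod>i<k. of_nat (m i))" for n
  proof -
    have "(\<Prod>i<k. \<Sum>c<m i. \<omega> i ^ (c * ep (p i) n) * cnj (\<omega> i ^ (c * a i))) =
        (\<Prod>i<k. if [ep (p i) n = a i] (mod m i) then of_nat (m i) else 0)"
      unfolding \<omega>_def cong_def using m
      by (intro prod.cong refl sum_unity_root_orthogonal) auto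
    also have "\<dots> = of_bool (\<forall>i<k. [ep (p i) n = a i] (mod m i)) * (\<Prod>i<k. of_nat (m i))"
      by (cases "\<forall>i<k. [ep (p i) n = a i] (mod m i)") (auto intro!: prod_zero)
    finally show ?thesis .
  qed
  have "of_nat (card {n. n < N \<and> (\<forall>i<k. [ep (p i) n = a i] (mod m i))}) =
      (\<Sum>n<N. of_bool (\<forall>i<k. [ep (p i) n = a i] (mod m i)) :: complex)"
    by (simp add: of_bool_def sum.If_cases Int_def)
  then have "of_nat (card {n. n < N \<and> (\<forall>i<k. [ep (p i) n = a i] (mod m i))}) *
        (\<Prod>i<k. of_nat (m i)) =
      (\<Sum>n<N. \<Prod>i<k. \<Sum>c<m i. \<omega> i ^ (c * ep (p i) n) * cnj (\<omega> i ^ (c * a i)))"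
    by (simp only: indicator sum_distrib_right)
  also have "\<dots> = (\<Sum>n<N. \<Sum>c\<in>PiE {..<k} (\<lambda>i. {..<m i}).
      \<Prod>i<k. \<omega> i ^ (c i * ep (p i) n) * cnj (\<omega> i ^ (c i * a i)))"
    by (intro sum.cong refl prod_sum_PiE) auto
  also have "\<dots> = (\<Sum>c\<in>PiE {..<k} (\<lambda>i. {..<m i}). \<Sum>n<N.
      \<Prod>i<k. \<omega> i ^ (c i * ep (p i) n) * cnj (\<omega> i ^ (c i * a i)))"
    by (rule sum.swap)
  finally show ?thesis
    by (simp only: prod.distrib sum_distrib_right sum_distrib_left power_mult mult.commute)
qed

text \<open>The zero frequency contributes N. Every other vector \<open>c\<close> has an l with
  \<omega> l ^ c l \<noteq> 1 and falls under the exponential sum bound. There are fewer than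
  \<open>W\<close> of these, so division by \<open>W\<close> leaves one copy of the error
  \<open>E\<close>. The residues \<open>a i\<close> enter only through factors of norm 1, hence the
  uniformity.\<close>

lemma card_ep_cong_bound:
  fixes k N :: nat and p m a :: "nat \<Rightarrow> nat" and \<beta> P :: real
  assumes k: "k > 0"
    and prime: "\<And>i. i < k \<Longrightarrow> prime (p i)"
    and inj: "inj_on p {..<k}"
    and m: "\<And>i. i < k \<Longrightarrow> m i > 0"
    and P: "\<And>i. i < k \<Longrightarrow> real (p i) \<le> P"
    and \<beta>: "0 < \<beta>" "\<beta> \<le> 1" "\<And>i. i < k \<Longrightarrow> \<beta> \<le> decay (p i) (m i) / (2 * real (p i))"
    and N: "N > 0"
  shows "\<bar>real (card {n. n < N \<and> (\<forall>i<k. [ep (p i) n = a i] (mod m i))})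
           - real N / (\<Prod>i<k. real (m i))\<bar> \<le>
    (2 + sqrt ((1 + P ^ k) * (2 * P\<^sup>2) + 2 * real k)) * real N powr (1 - \<beta> / (4 * real k))"
proof -
  define \<omega> where "\<omega> i = cis (2 * pi / real (m i))" for i
  define E where "E = (2 + sqrt ((1 + P ^ k) * (2 * P\<^sup>2) + 2 * real k)) *
    real N powr (1 - \<beta> / (4 * real k))"
  define V where "V = PiE {..<k} (\<lambda>i. {..<m i})"
  define S where "S c = (\<Prod>i<k. cnj (\<omega> i ^ (c i * a i))) *
    (\<Sum>n<N. \<Prod>i<k. (\<omega> i ^ c i) ^ ep (p i) n)" for c
  \<comment> \<open>The zero frequency vector; the restriction makes it a member of
    \<open>V\<close>, whose functions are \<open>undefined\<close> off
    \<open>{..<k}\<close>.\<close>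
  define v0 where "v0 = restrict (\<lambda>_. 0::nat) {..<k}"
  define W where "W = (\<Prod>i<k. real (m i))"
  define A where "A = card {n. n < N \<and> (\<forall>i<k. [ep (p i) n = a i] (mod m i))}"
  have W: "W > 0" unfolding W_def using m by (intro prod_pos) auto
  have finV: "finite V" unfolding V_def by (intro finite_PiE) auto
  have cardV: "real (card V) = W" by (simp add: V_def W_def card_PiE)
  have v0V: "v0 \<in> V" using m by (auto simp: V_def v0_def)
  have Sv0: "S v0 = of_nat N" by (simp add: S_def v0_def)
  have \<omega>1: "\<omega> i ^ m i = 1" if "i < k" for i using m[OF that] by (simp add: \<omega>_def DeMoivre)
  have S_le: "norm (S c) \<le> E" if c: "c \<in> V - {v0}" for c
  proof -
    have "\<exists>l<k. c l \<noteq> 0"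
    proof (rule ccontr)
      assume "\<not> ?thesis"
      then have "c = v0" using c by (intro ext) (auto simp: V_def v0_def PiE_def extensional_def)
      then show False using c by simp
    qed
    then obtain l where l: "l < k" "c l \<noteq> 0" by blast
    have cl: "c l < m l" using c l by (auto simp: V_def)
    have "\<omega> l ^ c l \<noteq> 1"
    proof
      assume "\<omega> l ^ c l = 1"
      then have "cis (2 * pi * real (c l) / real (m l)) = cis (2 * pi * real 0 / real (m l))"
        by (simp add: \<omega>_def DeMoivre mult_ac)
      then have "c l = 0"
        by (rule inj_onD[OF bij_betw_imp_inj_on[OF bij_betw_roots_unity[OF m[OF l(1)]]]])
           (use cl in auto)
      then show False using l by simp
    qed
    then have "norm (\<Sum>n<N. \<Prod>i<k. (\<omega> i ^ c i) ^ ep (p i) n) \<le> E"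
      unfolding E_def using \<omega>1 k prime inj m l P \<beta> N
      by (intro norm_exp_sum_le[where l = l and m = m])
         (auto simp flip: power_mult simp: mult.commute[of "c _"] power_mult)
    then show ?thesis
      by (simp add: S_def norm_mult norm_power \<omega>_def flip: prod_norm)
  qed
  have "complex_of_real (real A * W) = (\<Sum>c\<in>V. S c)"
    using card_ep_cong_eq_exp_sums[where k = k and m = m and N = N and p = p and a = a, OF m]
    by (simp add: A_def W_def V_def S_def \<omega>_def)
  also have "\<dots> = of_nat N + (\<Sum>c\<in>V - {v0}. S c)"
    using sum.remove[OF finV v0V, of S] by (simp add: Sv0)
  finally have "complex_of_real (real A * W - real N) = (\<Sum>c\<in>V - {v0}. S c)"
    by simp
  then have "\<bar>real A * W - real N\<bar> = norm (\<Sum>c\<in>V - {v0}. S c)"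
    by (metis norm_of_real)
  also have "\<dots> \<le> (\<Sum>c\<in>V - {v0}. E)" using S_le by (rule sum_norm_le)
  also have "\<dots> \<le> (\<Sum>c\<in>V. E)"
  proof (rule sum_mono2[OF finV])
    have "P \<ge> 0" using P[of 0] k by (meson of_nat_0_le_iff order_trans)
    then show "0 \<le> E" for c by (simp add: E_def)
  qed auto
  also have "\<dots> = W * E" by (simp add: cardV)
  finally have "\<bar>real A * W - real N\<bar> \<le> W * E" .
  moreover have "real A * W - real N = W * (real A - real N / W)"
    using W by (simp add: field_simps)
  ultimately have "W * \<bar>real A - real N / W\<bar> \<le> W * E"
    using W by (simp add: abs_mult)
  then show ?thesis using W by (simp add: A_def W_def E_def)
qed

text \<open>The right side is 1 / (2 p^2 (p + 1)^2 m^2). It suffices that 8 (p + 1)^2 \<le> 32 p^2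
  \<le> 120 p^4 and that p^6 \<le> P^(3M), the latter because M \<ge> 2. The factor 4 k matches the
  exponent \<beta> / (4k) of the exponential sum bound.\<close>

lemma delta_le_decay:
  assumes "2 \<le> p" "p \<le> P" "2 \<le> m" "m \<le> M" "1 \<le> k"
  defines "\<delta> \<equiv> 1 / (120 * real k ^ 2 * real P ^ (3 * M) * real M ^ 2)"
  shows "4 * real k * \<delta> \<le> decay p m / (2 * real p)"
proof -
  have "real p ^ 6 \<le> real P ^ 6" using assms by (intro power_mono) auto
  also have "\<dots> \<le> real P ^ (3 * M)" using assms by (intro power_increasing) auto
  finally have P6: "real p ^ 6 \<le> real P ^ (3 * M)" .
  have "8 * (real p + 1)\<^sup>2 \<le> 8 * (2 * real p)\<^sup>2"
    using assms by (intro mult_left_mono power_mono) auto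
  also have "\<dots> \<le> 120 * real p ^ 4"
  proof -
    have "1 \<le> (real p)\<^sup>2" using assms by simp
    then have "32 * (real p)\<^sup>2 * 1 \<le> 120 * (real p)\<^sup>2 * (real p)\<^sup>2" by (intro mult_mono) auto
    then show ?thesis by (simp add: power2_eq_square power4_eq_xxxx mult_ac)
  qed
  finally have "8 * (real p + 1)\<^sup>2 * ((real p)\<^sup>2 * (real m)\<^sup>2 * real k) \<le>
      120 * real p ^ 4 * ((real p)\<^sup>2 * (real m)\<^sup>2 * real k)"
    by (intro mult_right_mono) auto
  also have "\<dots> = 120 * real k * real p ^ 6 * (real m)\<^sup>2"
    by (simp add: algebra_simps flip: power_add)
  also have "\<dots> \<le> 120 * (real k)\<^sup>2 * real P ^ (3 * M) * (real M)\<^sup>2"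
    using assms P6 by (intro mult_mono power_mono) (auto simp: power2_eq_square)
  finally have le: "4 * real k * (2 * real p * (real p * (real p + 1)\<^sup>2 * (real m)\<^sup>2)) \<le>
      120 * (real k)\<^sup>2 * real P ^ (3 * M) * (real M)\<^sup>2"
    by (simp add: power2_eq_square mult_ac)
  have pos: "0 < 2 * real p * (real p * (real p + 1)\<^sup>2 * (real m)\<^sup>2)"
    using assms by (intro mult_pos_pos) auto
  have pos2: "0 < 120 * (real k)\<^sup>2 * real P ^ (3 * M) * (real M)\<^sup>2"
    using assms by (intro mult_pos_pos) auto
  have "4 * real k * \<delta> = 4 * real k / (120 * (real k)\<^sup>2 * real P ^ (3 * M) * (real M)\<^sup>2)"
    by (simp add: \<delta>_def)
  also have "\<dots> \<le> 1 / (2 * real p * (real p * (real p + 1)\<^sup>2 * (real m)\<^sup>2))"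
    using le pos pos2
    by (simp only: pos_divide_le_eq pos_le_divide_eq times_divide_eq_left mult_1_left)
  also have "\<dots> = decay p m / (2 * real p)" by (simp add: decay_def)
  finally show ?thesis .
qed

text \<open>The choice \<beta> = 4 k \<delta> is admissible for all primes at once, and the constant
  depends only on k and the largest prime, so it can be chosen before \<open>a\<close>. Positivity
  of \<delta> is recorded for deducing the asymptotic.\<close>

lemma card_ep_cong_power_saving:
  fixes k :: nat and p m :: "nat \<Rightarrow> nat"
  assumes k: "k \<ge> 1" and prime: "\<forall>i<k. prime (p i)" and inj: "inj_on p {..<k}"
    and m: "\<forall>i<k. m i \<ge> 2"
  defines "\<delta> \<equiv> 1 / (120 * real k ^ 2 * real (Max (p ` {..<k})) ^ (3 * Max (m ` {..<k}))
                      * real (Max (m ` {..<k})) ^ 2)"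
  shows "\<delta> > 0" and "\<exists>C. \<forall>a. \<forall>N\<ge>1.
    \<bar>real (card {n. n < N \<and> (\<forall>i<k. [ep (p i) n = a i] (mod m i))}) - real N / (\<Prod>i<k. real (m i))\<bar>
      \<le> C * real N powr (1 - \<delta>)"
proof -
  define P where "P = Max (p ` {..<k})"
  define M where "M = Max (m ` {..<k})"
  have P: "p i \<le> P" and M: "m i \<le> M" if "i < k" for i
    using that by (auto simp: P_def M_def intro!: Max_ge)
  have p2: "2 \<le> p i" if "i < k" for i using prime that prime_ge_2_nat by blast
  have "P > 0" "M > 0" using P[of 0] M[of 0] p2[of 0] m k by force+
  then show pos: "\<delta> > 0" using k unfolding \<delta>_def P_def[symmetric] M_def[symmetric] by simp
  define \<beta> where "\<beta> = 4 * real k * \<delta>"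
  have \<beta>: "\<beta> \<le> decay (p i) (m i) / (2 * real (p i))" if "i < k" for i
    unfolding \<beta>_def \<delta>_def P_def[symmetric] M_def[symmetric]
    using that p2 P M m k by (intro delta_le_decay) auto
  have "decay (p 0) (m 0) / (2 * real (p 0)) \<le> 1 / 1"
    using decay_bounds[of "p 0" "m 0"] p2[of 0] m k by (intro frac_le) force+
  then have \<beta>1: "\<beta> \<le> 1" using \<beta>[of 0] k by simp
  have \<beta>0: "0 < \<beta>" using pos k by (simp add: \<beta>_def)
  have \<delta>: "\<beta> / (4 * real k) = \<delta>" using k by (simp add: \<beta>_def)
  have "\<bar>real (card {n. n < N \<and> (\<forall>i<k. [ep (p i) n = a i] (mod m i))}) - real N / (\<Prod>i<k. real (m i))\<bar>
      \<le> (2 + sqrt ((1 + real P ^ k) * (2 * (real P)\<^sup>2) + 2 * real k)) * real N powr (1 - \<delta>)"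
    if "N \<ge> 1" for N a
    unfolding \<delta>[symmetric]
    by (rule card_ep_cong_bound) (use k prime inj m P \<beta> \<beta>0 \<beta>1 that in \<open>force+\<close>)
  then show "\<exists>C. \<forall>a. \<forall>N\<ge>1.
    \<bar>real (card {n. n < N \<and> (\<forall>i<k. [ep (p i) n = a i] (mod m i))}) - real N / (\<Prod>i<k. real (m i))\<bar>
      \<le> C * real N powr (1 - \<delta>)"
    by blast
qed

section \<open>From the error term to the asymptotic and the final statement\<close>

lemma asymp_equiv_linear_of_power_saving:
  fixes f :: "nat \<Rightarrow> real"
  assumes "\<delta> > 0" "c \<noteq> 0" "\<And>N. N \<ge> 1 \<Longrightarrow> \<bar>f N - real N / c\<bar> \<le> C * real N powr (1 - \<delta>)"
  shows "f \<sim>[at_top] (\<lambda>N. real N / c)"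
proof (rule smallo_imp_asymp_equiv)
  have "(\<lambda>N. f N - real N / c) \<in> O(\<lambda>N. real N powr (1 - \<delta>))"
  proof (rule bigoI)
    show "\<forall>\<^sub>F N in at_top. norm (f N - real N / c) \<le> C * norm (real N powr (1 - \<delta>))"
      using eventually_ge_at_top[of "1::nat"] by eventually_elim (use assms(3) in simp)
  qed
  also have "(\<lambda>N. real N powr (1 - \<delta>)) \<in> o(\<lambda>N. real N powr 1)"
    using assms(1) by (subst powr_smallo_iff[OF filterlim_real_sequentially]) auto
  also have "(\<lambda>N. real N powr 1) \<in> O(\<lambda>N. real N / c)"
    using assms(2) by simp
  finally show "(\<lambda>N. f N - real N / c) \<in> o(\<lambda>N. real N / c)" .
qed

theorem theorem1:
  shows
  "(\<forall>(k::nat) (p::nat \<Rightarrow> nat) (m::nat \<Rightarrow> nat).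
      k \<ge> 1 \<and> (\<forall>i<k. prime (p i)) \<and> inj_on p {..<k} \<and>
      (\<forall>i<k. m i \<ge> 2 \<and> \<not> p i dvd m i) \<longrightarrow>
      (let mm = Max (m ` {..<k}); pp = Max (p ` {..<k});
           \<delta> = 1 / (120 * real k ^ 2 * real pp ^ (3 * mm) * real mm ^ 2)
       in \<exists>C::real. \<exists>N0::nat. \<forall>a::nat \<Rightarrow> nat. \<forall>N\<ge>N0.
            (\<forall>i<k. a i \<le> m i - 1) \<longrightarrow>
            \<bar>real (card {n. n < N \<and> (\<forall>i<k. [ep (p i) n = a i] (mod m i))})
               - real N / (\<Prod>i<k. real (m i))\<bar>
            \<le> C * real N powr (1 - \<delta>)))
   \<and>
   (\<forall>(k::nat) (p::nat \<Rightarrow> nat) (\<epsilon>::nat \<Rightarrow> nat).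
      k \<ge> 1 \<and> (\<forall>i<k. prime (p i) \<and> odd (p i)) \<and> inj_on p {..<k} \<and>
      (\<forall>i<k. \<epsilon> i \<in> {0, 1}) \<longrightarrow>
      (\<lambda>N. real (card {n. n < N \<and> (\<forall>i<k. [ep (p i) n = \<epsilon> i] (mod 2))}))
        \<sim>[at_top] (\<lambda>N. real N / 2 ^ k))"
proof (intro conjI allI impI, goal_cases)
  case (1 k p m)
  \<comment> \<open>The witness for \<open>N0\<close> is 1.\<close>
  then show ?case
    unfolding Let_def using card_ep_cong_power_saving(2)[of k p m] by blast
next
  case (2 k p \<epsilon>)
  \<comment> \<open>The last fact is the condition on the moduli for the constant function 2; it
    fixes \<open>m\<close> in the general bound, and the product of the moduli becomes 2^k.\<close>
  then have hyp: "k \<ge> 1" "\<forall>i<k. prime (p i)" "inj_on p {..<k}" "\<forall>i<k. (2::nat) \<ge> 2"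
    by auto
  from card_ep_cong_power_saving[OF hyp] obtain \<delta> C :: real where "\<delta> > 0" and
    C: "\<forall>a. \<forall>N\<ge>1. \<bar>real (card {n. n < N \<and> (\<forall>i<k. [ep (p i) n = a i] (mod 2))}) -
      real N / (\<Prod>i<k. real 2)\<bar> \<le> C * real N powr (1 - \<delta>)"
    by blast
  show ?case
  proof (rule asymp_equiv_linear_of_power_saving[OF \<open>\<delta> > 0\<close>, where C = C])
    show "\<bar>real (card {n. n < N \<and> (\<forall>i<k. [ep (p i) n = \<epsilon> i] (mod 2))}) - real N / 2 ^ k\<bar>
        \<le> C * real N powr (1 - \<delta>)" if "N \<ge> 1" for N
      using C[rule_format, of N \<epsilon>] that by simp
  qed simp
qed

end
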